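(* Let $V$ be a vertex operator algebra. (a) If $g(V)_{\ge0}V=V$, then every $g(V)_{\ge0}$-homomorphism between weak $V$-modules is a $V$-homomorphism, and every quasi-intertwining operator among any weak $V$-modules is an intertwining operator. (b) If $g(V)_{\ge0}V\ne V$ and $\dim V>1$, then there exist $V$-modules $W_1,W_2$ and a $g(V)_{\ge0}$-homomorphism $W_1\to W_2$ that is not a $V$-homomorphism, and there exist $V$-modules and a quasi-intertwining operator among them that is not an intertwining operator.
   Context: A weak $V$-module is a module for $V$ regarded as a vertex algebra; $L(-1)=\omega_0$. $g(V)_{\ge0}W=\mathrm{span}\{v_nw\mid v\in V,n\ge0,w\in W\}$ for a weak module $W$ ($Y_W(v,x)=\sum_nv_nx^{-n-1}$). A $g(V)_{\ge0}$-homomorphism is a linear map $f$ with $f(v_nw)=v_nf(w)$ for $v\in V$, $n\ge0$; a $V$-homomorphism satisfies this for all $n\in\mathbb Z$. A quasi-intertwining operator of type $\binom{W_3}{W_1\,W_2}$ is a linear map $W_1\otimes W_2\to W_3\{x\}$, $w_{(1)}\otimes w_{(2)}\mapsto{\mathcal Y}(w_{(1)},x)w_{(2)}=\sum_{n\in\mathbb C}(w_{(1)})_nw_{(2)}x^{-n-1}$, with $(w_{(1)})_nw_{(2)}=0$ for $\mathrm{Re}\,n\gg0$, the commutator formula $Y_3(v,x_1){\mathcal Y}(w_{(1)},x_2)w_{(2)}-{\mathcal Y}(w_{(1)},x_2)Y_2(v,x_1)w_{(2)}=\mathrm{Res}_{x_0}x_2^{-1}\delta(\frac{x_1-x_0}{x_2}){\mathcal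 Y}(Y_1(v,x_0)w_{(1)},x_2)w_{(2)}$, and $\frac{d}{dx}{\mathcal Y}(w_{(1)},x)={\mathcal Y}(L(-1)w_{(1)},x)$. It is an intertwining operator if moreover $x_0^{-1}\delta(\frac{x_1-x_2}{x_0})Y_3(v,x_1){\mathcal Y}(w_{(1)},x_2)w_{(2)}-x_0^{-1}\delta(\frac{x_2-x_1}{-x_0}){\mathcal Y}(w_{(1)},x_2)Y_2(v,x_1)w_{(2)}=x_2^{-1}\delta(\frac{x_1-x_0}{x_2}){\mathcal Y}(Y_1(v,x_0)w_{(1)},x_2)w_{(2)}$. *)

theory Defs
  imports Complex_Main "HOL-Library.Groups_Big_Fun"
begin

(* Conventions.  A complex vector space is a type 'a::ab_group_add with a scalar
   multiplication s :: complex => 'a => 'a satisfying the library locale vector_space.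
   A vertex operator  Y(u,x)v = sum_n u_n v x^{-n-1}  is recorded by its modes:
   Y u v n = u_n v  (n :: int).  Formal series with complex exponents
   (quasi-)intertwining operators are recorded by their coefficients
   Yc w1 w2 n = (w1)_n w2  (n :: complex). *)

text \<open>Borcherds (component) form of the Jacobi identity for a module (YW) over (Y):
  sum_i binom(m,i) (u_{l+i} v)_{m+n-i} w
   = sum_i (-1)^i binom(l,i) ( u_{l+m-i} v_{n+i} w - (-1)^l v_{l+n-i} u_{m+i} w ).
  All sums are finite by the truncation condition.\<close>
definition jacobi_modes ::
  "('v \<Rightarrow> 'v \<Rightarrow> int \<Rightarrow> 'v) \<Rightarrow> (complex \<Rightarrow> 'w::ab_group_add \<Rightarrow> 'w)
   \<Rightarrow> ('v \<Rightarrow> 'w \<Rightarrow> int \<Rightarrow> 'w) \<Rightarrow> bool" where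
  "jacobi_modes Y sW YW \<longleftrightarrow>
    (\<forall>u v w l m n.
      Sum_any (\<lambda>i::nat. sW (of_int m gchoose i) (YW (Y u v (l + int i)) w (m + n - int i)))
      = Sum_any (\<lambda>i::nat. sW ((-1) ^ i * (of_int l gchoose i))
            (YW u (YW v w (n + int i)) (l + m - int i)
             - sW ((-1::complex) powi l) (YW v (YW u w (m + int i)) (l + n - int i)))))"

definition weak_module ::
  "(complex \<Rightarrow> 'v::ab_group_add \<Rightarrow> 'v) \<Rightarrow> ('v \<Rightarrow> 'v \<Rightarrow> int \<Rightarrow> 'v) \<Rightarrow> 'v
   \<Rightarrow> (complex \<Rightarrow> 'w::ab_group_add \<Rightarrow> 'w) \<Rightarrow> ('v \<Rightarrow> 'w \<Rightarrow> int \<Rightarrow> 'w) \<Rightarrow> bool" where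
  "weak_module sV Y vac sW YW \<longleftrightarrow>
     vector_space sW \<and>
     (\<forall>w n. Vector_Spaces.linear sV sW (\<lambda>v. YW v w n)) \<and>
     (\<forall>v n. Vector_Spaces.linear sW sW (\<lambda>w. YW v w n)) \<and>
     (\<forall>v w. \<exists>N. \<forall>n\<ge>N. YW v w n = 0) \<and>
     (\<forall>w n. YW vac w n = (if n = -1 then w else 0)) \<and>
     jacobi_modes Y sW YW"

definition vertex_algebra ::
  "(complex \<Rightarrow> 'v::ab_group_add \<Rightarrow> 'v) \<Rightarrow> ('v \<Rightarrow> 'v \<Rightarrow> int \<Rightarrow> 'v) \<Rightarrow> 'v \<Rightarrow> bool" where
  "vertex_algebra sV Y vac \<longleftrightarrow>
     vector_space sV \<and> weak_module sV Y vac sV Y \<and>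
     (\<forall>v n. n \<ge> 0 \<longrightarrow> Y v vac n = 0) \<and> (\<forall>v. Y v vac (-1) = v)"

definition eigensp :: "(complex \<Rightarrow> 'w \<Rightarrow> 'w) \<Rightarrow> ('w \<Rightarrow> 'w) \<Rightarrow> complex \<Rightarrow> 'w set" where
  "eigensp s L h = {w. L w = s h w}"

definition fin_dim_subset :: "(complex \<Rightarrow> 'w::ab_group_add \<Rightarrow> 'w) \<Rightarrow> 'w set \<Rightarrow> bool" where
  "fin_dim_subset s S \<longleftrightarrow> (\<exists>B. finite B \<and> S \<subseteq> module.span s B)"

text \<open>Vertex operator algebra with conformal vector om of central charge c;
  L(n) = om_{n+1}.\<close>
definition VOA ::
  "(complex \<Rightarrow> 'v::ab_group_add \<Rightarrow> 'v) \<Rightarrow> ('v \<Rightarrow> 'v \<Rightarrow> int \<Rightarrow> 'v) \<Rightarrow> 'v \<Rightarrow> 'v \<Rightarrow> complex \<Rightarrow> bool" where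
  "VOA sV Y vac om c \<longleftrightarrow>
     vertex_algebra sV Y vac \<and>
     (\<forall>m n v. Y om (Y om v (n + 1)) (m + 1) - Y om (Y om v (m + 1)) (n + 1)
        = sV (of_int (m - n)) (Y om v (m + n + 1))
          + (if m + n = 0 then sV ((of_int m ^ 3 - of_int m) / 12 * c) v else 0)) \<and>
     (\<forall>v w n. Y (Y om v 0) w n = sV (- of_int n) (Y v w (n - 1))) \<and>
     (\<forall>v. v \<in> module.span sV (\<Union>n::int. eigensp sV (\<lambda>x. Y om x 1) (of_int n))) \<and>
     (\<forall>n::int. fin_dim_subset sV (eigensp sV (\<lambda>x. Y om x 1) (of_int n))) \<and>
     (\<exists>N::int. \<forall>n<N. eigensp sV (\<lambda>x. Y om x 1) (of_int n) = {0})"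

definition VOA_module ::
  "(complex \<Rightarrow> 'v::ab_group_add \<Rightarrow> 'v) \<Rightarrow> ('v \<Rightarrow> 'v \<Rightarrow> int \<Rightarrow> 'v) \<Rightarrow> 'v \<Rightarrow> 'v
   \<Rightarrow> (complex \<Rightarrow> 'w::ab_group_add \<Rightarrow> 'w) \<Rightarrow> ('v \<Rightarrow> 'w \<Rightarrow> int \<Rightarrow> 'w) \<Rightarrow> bool" where
  "VOA_module sV Y vac om sW YW \<longleftrightarrow>
     weak_module sV Y vac sW YW \<and>
     (\<forall>w. w \<in> module.span sW (\<Union>h. eigensp sW (\<lambda>x. YW om x 1) h)) \<and>
     (\<forall>h. fin_dim_subset sW (eigensp sW (\<lambda>x. YW om x 1) h)) \<and>
     (\<forall>h. \<exists>N::int. \<forall>k<N. eigensp sW (\<lambda>x. YW om x 1) (h + of_int k) = {0})"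

definition gpos :: "(complex \<Rightarrow> 'w::ab_group_add \<Rightarrow> 'w) \<Rightarrow> ('v \<Rightarrow> 'w \<Rightarrow> int \<Rightarrow> 'w) \<Rightarrow> 'w set" where
  "gpos sW YW = module.span sW {YW v w n | v w n. n \<ge> 0}"

definition gpos_hom ::
  "(complex \<Rightarrow> 'w1::ab_group_add \<Rightarrow> 'w1) \<Rightarrow> ('v \<Rightarrow> 'w1 \<Rightarrow> int \<Rightarrow> 'w1)
   \<Rightarrow> (complex \<Rightarrow> 'w2::ab_group_add \<Rightarrow> 'w2) \<Rightarrow> ('v \<Rightarrow> 'w2 \<Rightarrow> int \<Rightarrow> 'w2) \<Rightarrow> ('w1 \<Rightarrow> 'w2) \<Rightarrow> bool" where
  "gpos_hom s1 Y1 s2 Y2 f \<longleftrightarrow> Vector_Spaces.linear s1 s2 f \<and>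
     (\<forall>v w n. n \<ge> 0 \<longrightarrow> f (Y1 v w n) = Y2 v (f w) n)"

definition V_hom ::
  "(complex \<Rightarrow> 'w1::ab_group_add \<Rightarrow> 'w1) \<Rightarrow> ('v \<Rightarrow> 'w1 \<Rightarrow> int \<Rightarrow> 'w1)
   \<Rightarrow> (complex \<Rightarrow> 'w2::ab_group_add \<Rightarrow> 'w2) \<Rightarrow> ('v \<Rightarrow> 'w2 \<Rightarrow> int \<Rightarrow> 'w2) \<Rightarrow> ('w1 \<Rightarrow> 'w2) \<Rightarrow> bool" where
  "V_hom s1 Y1 s2 Y2 f \<longleftrightarrow> Vector_Spaces.linear s1 s2 f \<and>
     (\<forall>v w n. f (Y1 v w n) = Y2 v (f w) n)"

text \<open>Quasi-intertwining operator of type (W3 / W1 W2); Yc w1 w2 n = (w1)_n w2, n complex.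
  Commutator formula in components: [v_m, (w1)_n] w2 = sum_i binom(m,i) (v_i w1)_{m+n-i} w2.
  L(-1)-derivative property in components: (L(-1) w1)_n = -n (w1)_{n-1}.\<close>
definition quasi_intertwining ::
  "'v \<Rightarrow> (complex \<Rightarrow> 'w1::ab_group_add \<Rightarrow> 'w1) \<Rightarrow> ('v \<Rightarrow> 'w1 \<Rightarrow> int \<Rightarrow> 'w1)
   \<Rightarrow> (complex \<Rightarrow> 'w2::ab_group_add \<Rightarrow> 'w2) \<Rightarrow> ('v \<Rightarrow> 'w2 \<Rightarrow> int \<Rightarrow> 'w2)
   \<Rightarrow> (complex \<Rightarrow> 'w3::ab_group_add \<Rightarrow> 'w3) \<Rightarrow> ('v \<Rightarrow> 'w3 \<Rightarrow> int \<Rightarrow> 'w3)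
   \<Rightarrow> ('w1 \<Rightarrow> 'w2 \<Rightarrow> complex \<Rightarrow> 'w3) \<Rightarrow> bool" where
  "quasi_intertwining om s1 Y1 s2 Y2 s3 Y3 Yc \<longleftrightarrow>
     (\<forall>w2 n. Vector_Spaces.linear s1 s3 (\<lambda>w1. Yc w1 w2 n)) \<and>
     (\<forall>w1 n. Vector_Spaces.linear s2 s3 (\<lambda>w2. Yc w1 w2 n)) \<and>
     (\<forall>w1 w2. \<exists>R::real. \<forall>n. Re n > R \<longrightarrow> Yc w1 w2 n = 0) \<and>
     (\<forall>v w1 w2 (m::int) (n::complex).
        Y3 v (Yc w1 w2 n) m - Yc w1 (Y2 v w2 m) n
        = Sum_any (\<lambda>i::nat. s3 (of_int m gchoose i)
             (Yc (Y1 v w1 (int i)) w2 (of_int m + n - of_nat i)))) \<and>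
     (\<forall>w1 w2 n. Yc (Y1 om w1 0) w2 n = s3 (- n) (Yc w1 w2 (n - 1)))"

text \<open>Intertwining operator: quasi-intertwining plus the Jacobi identity, in components
  (l, m integers, n complex):
  sum_i binom(m,i) (v_{l+i} w1)_{m+n-i} w2
   = sum_i (-1)^i binom(l,i) ( v_{l+m-i} (w1)_{n+i} w2 - (-1)^l (w1)_{l+n-i} v_{m+i} w2 ).\<close>
definition intertwining ::
  "'v \<Rightarrow> (complex \<Rightarrow> 'w1::ab_group_add \<Rightarrow> 'w1) \<Rightarrow> ('v \<Rightarrow> 'w1 \<Rightarrow> int \<Rightarrow> 'w1)
   \<Rightarrow> (complex \<Rightarrow> 'w2::ab_group_add \<Rightarrow> 'w2) \<Rightarrow> ('v \<Rightarrow> 'w2 \<Rightarrow> int \<Rightarrow> 'w2)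
   \<Rightarrow> (complex \<Rightarrow> 'w3::ab_group_add \<Rightarrow> 'w3) \<Rightarrow> ('v \<Rightarrow> 'w3 \<Rightarrow> int \<Rightarrow> 'w3)
   \<Rightarrow> ('w1 \<Rightarrow> 'w2 \<Rightarrow> complex \<Rightarrow> 'w3) \<Rightarrow> bool" where
  "intertwining om s1 Y1 s2 Y2 s3 Y3 Yc \<longleftrightarrow>
     quasi_intertwining om s1 Y1 s2 Y2 s3 Y3 Yc \<and>
     (\<forall>v w1 w2 (l::int) (m::int) (n::complex).
        Sum_any (\<lambda>i::nat. s3 (of_int m gchoose i)
             (Yc (Y1 v w1 (l + int i)) w2 (of_int m + n - of_nat i)))
        = Sum_any (\<lambda>i::nat. s3 ((-1) ^ i * (of_int l gchoose i))
             (Y3 v (Yc w1 w2 (n + of_nat i)) (l + m - int i)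
              - s3 ((-1::complex) powi l) (Yc w1 (Y2 v w2 (m + int i)) (of_int l + n - of_nat i)))))"

text \<open>dim V > 1, i.e. V is not spanned by a single vector (this also covers
  infinite-dimensional V, where the library's dim returns 0).\<close>
definition dim_gt_one :: "(complex \<Rightarrow> 'v::ab_group_add \<Rightarrow> 'v) \<Rightarrow> bool" where
  "dim_gt_one sV \<longleftrightarrow> \<not> (\<exists>b. module.span sV {b} = UNIV)"

end

theory Submission
  imports Defs
begin

text \<open>
  If \<open>V\<close> is spanned by the \<open>v\<^sub>n w\<close> with \<open>n \<ge> 0\<close>, then so is every weak module, as \<open>w = 1\<^sub>-\<^sub>1 w\<close>.
  For a homomorphism \<open>f\<close> of the nonnegative modes put \<open>D a p w = f (a\<^sub>p w) - a\<^sub>p (f w)\<close>. In the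
  Jacobi identity for \<open>(l, m, n)\<close> with \<open>m\<close> large and \<open>n \<ge> 0\<close>, the iterate side involves only
  nonnegative modes and one of the two products vanishes; applying \<open>f\<close> leaves a relation among the
  \<open>D a (l + m - i) (b\<^sub>n\<^sub>+\<^sub>i w)\<close> with \<open>l\<close> arbitrary, and downward induction on \<open>n\<close> gives
  \<open>D a p (b\<^sub>n w) = 0\<close>.

  A quasi-intertwining operator is treated in the same way, with the map \<open>w\<^sub>1 \<mapsto> Yc(w\<^sub>1, x)\<close> in the role
  of \<open>f\<close> and \<open>a\<^sub>l\<close> acting on a series \<open>\<Phi>(x)\<close> by the residue of
  \<open>(x\<^sub>1 - x)\<^sup>l Y(a, x\<^sub>1) \<Phi>(x) - (-x + x\<^sub>1)\<^sup>l \<Phi>(x) Y(a, x\<^sub>1)\<close>. The Jacobi identity needed for this action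
  follows by multiplying \<open>[Y(Y(a, x\<^sub>0) b, x\<^sub>2), Yc(w\<^sub>1, x)]\<close> by powers of \<open>x\<^sub>1 - x\<close> and \<open>x\<^sub>2 - x\<close>.

  Conversely, a nonzero functional \<open>\<lambda>\<close> on \<open>V\<close> that vanishes on all \<open>v\<^sub>n w\<close> with \<open>n \<ge> 0\<close> yields the
  counterexamples \<open>v \<mapsto> \<lambda>(v) 1\<close> and \<open>Yc(w\<^sub>1, x) w\<^sub>2 = \<lambda>(w\<^sub>1) w\<^sub>2\<close>.
\<close>

section \<open>Eventually vanishing sums\<close>

text \<open>\<open>Sum_any\<close> is 0 on infinite support, so sums may be split or transformed
  only when the support is finite. Vanishing from some index on is the form that the truncation
  conditions provide.\<close>

definition eventually_zero :: "(nat \<Rightarrow> 'a::zero) \<Rightarrow> bool" where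
  "eventually_zero f \<longleftrightarrow> (\<exists>N. \<forall>i\<ge>N. f i = 0)"

lemma eventually_zero_mono: "eventually_zero f \<Longrightarrow> (\<And>i. f i = 0 \<Longrightarrow> g i = 0) \<Longrightarrow> eventually_zero g"
  unfolding eventually_zero_def by meson

lemma eventually_zero_mono2:
  assumes "eventually_zero f" "eventually_zero g" "\<And>i. f i = 0 \<Longrightarrow> g i = 0 \<Longrightarrow> h i = 0"
  shows "eventually_zero h"
proof -
  obtain N M where "\<forall>i\<ge>N. f i = 0" "\<forall>i\<ge>M. g i = 0"
    using assms(1,2) by (auto simp: eventually_zero_def)
  then have "\<forall>i\<ge>max N M. h i = 0" using assms(3) by simp
  then show ?thesis unfolding eventually_zero_def by blast
qed

lemma eventually_zero_finite: "eventually_zero f \<Longrightarrow> finite {i. f i \<noteq> 0}"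
proof -
  assume "eventually_zero f"
  then obtain N where "\<forall>i\<ge>N. f i = 0" by (auto simp: eventually_zero_def)
  then have "{i. f i \<noteq> 0} \<subseteq> {..<N}" by (auto simp: not_le[symmetric])
  then show ?thesis using finite_subset by blast
qed

lemma eventually_zero_Suc: "eventually_zero f \<Longrightarrow> eventually_zero (\<lambda>i. f (Suc i))"
  unfolding eventually_zero_def by (meson le_SucI)

lemma eventually_zero_shift: "eventually_zero f \<Longrightarrow> eventually_zero (\<lambda>i. f (k + i))"
  unfolding eventually_zero_def by (meson trans_le_add2)

lemma Sum_any_lessThan:
  fixes f :: "nat \<Rightarrow> 'a::comm_monoid_add"
  assumes "\<And>i. i \<ge> N \<Longrightarrow> f i = 0"
  shows "Sum_any f = sum f {..<N}"
  by (rule Sum_any.expand_superset) (use assms in \<open>auto simp: not_le[symmetric]\<close>)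

lemma Sum_any_add:
  fixes f g :: "nat \<Rightarrow> 'a::comm_monoid_add"
  shows "eventually_zero f \<Longrightarrow> eventually_zero g \<Longrightarrow> Sum_any (\<lambda>i. f i + g i) = Sum_any f + Sum_any g"
  by (rule Sum_any.distrib) (auto intro: eventually_zero_finite)

lemma Sum_any_diff:
  fixes f g :: "nat \<Rightarrow> 'a::ab_group_add"
  assumes "eventually_zero f" "eventually_zero g"
  shows "Sum_any (\<lambda>i. f i - g i) = Sum_any f - Sum_any g"
proof -
  have "eventually_zero (\<lambda>i. f i - g i)" by (rule eventually_zero_mono2[OF assms]) simp
  from Sum_any_add[OF this assms(2)] show ?thesis by simp
qed

lemma Sum_any_Suc:
  fixes f :: "nat \<Rightarrow> 'a::comm_monoid_add"
  assumes "eventually_zero f"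
  shows "Sum_any f = f 0 + Sum_any (\<lambda>i. f (Suc i))"
proof -
  obtain N where N: "\<And>i. i \<ge> N \<Longrightarrow> f i = 0" using assms by (auto simp: eventually_zero_def)
  have "Sum_any f = sum f {..<Suc N}" by (rule Sum_any_lessThan) (use N in auto)
  moreover have "Sum_any (\<lambda>i. f (Suc i)) = sum (\<lambda>i. f (Suc i)) {..<N}"
    by (rule Sum_any_lessThan) (use N in auto)
  ultimately show ?thesis by (simp only: sum.lessThan_Suc_shift)
qed

lemma Sum_any_shift:
  fixes f :: "nat \<Rightarrow> 'a::comm_monoid_add"
  assumes "eventually_zero f" "\<And>i. i < k \<Longrightarrow> f i = 0"
  shows "Sum_any f = Sum_any (\<lambda>i. f (k + i))"
  using assms
proof (induction k arbitrary: f)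
  case (Suc k)
  have "Sum_any f = Sum_any (\<lambda>i. f (Suc i))"
    using Sum_any_Suc[OF Suc.prems(1)] Suc.prems(2)[of 0] by simp
  also have "\<dots> = Sum_any (\<lambda>i. f (Suc (k + i)))"
    by (rule Suc.IH[OF eventually_zero_Suc[OF Suc.prems(1)]]) (simp add: Suc.prems(2))
  finally show ?case by simp
qed simp

section \<open>Double sums supported in a square\<close>

definition eventually_zero2 :: "(nat \<Rightarrow> nat \<Rightarrow> 'a::zero) \<Rightarrow> bool" where
  "eventually_zero2 f \<longleftrightarrow> (\<exists>N. \<forall>i j. i \<ge> N \<or> j \<ge> N \<longrightarrow> f i j = 0)"

text \<open>From column \<open>J\<close> on all entries vanish; the finitely many remaining columns
  have a common bound. Separate bounds for the columns would not permit an interchange of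
  summation.\<close>

lemma eventually_zero2I_right:
  assumes "\<exists>J. \<forall>j\<ge>J. \<forall>i. f i j = 0" "\<And>j. eventually_zero (\<lambda>i. f i j)"
  shows "eventually_zero2 f"
proof -
  obtain J where J: "\<And>i j. j \<ge> J \<Longrightarrow> f i j = 0" using assms(1) by blast
  have "\<forall>j. \<exists>N. \<forall>i\<ge>N. f i j = 0" using assms(2) unfolding eventually_zero_def by blast
  then obtain N where N: "\<And>i j. i \<ge> N j \<Longrightarrow> f i j = 0" by metis
  define M where "M = max J (Max (N ` {..J}))"
  have "N j \<le> M" if "j \<le> J" for j
    using that by (auto simp: M_def intro!: max.coboundedI2 Max_ge)
  then have "f i j = 0" if "i \<ge> M \<or> j \<ge> M" for i j
    using that N J by (metis (no_types, lifting) M_def dual_order.trans linorder_le_cases max.cobounded1)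
  then show ?thesis unfolding eventually_zero2_def by blast
qed

lemma eventually_zero2_flip: "eventually_zero2 f \<Longrightarrow> eventually_zero2 (\<lambda>i j. f j i)"
  unfolding eventually_zero2_def by meson

lemma eventually_zero2I_left:
  assumes "\<exists>J. \<forall>i\<ge>J. \<forall>j. f i j = 0" "\<And>i. eventually_zero (\<lambda>j. f i j)"
  shows "eventually_zero2 f"
  using eventually_zero2_flip[OF eventually_zero2I_right[of "\<lambda>j i. f i j"]] assms by simp

lemma eventually_zero2_row: "eventually_zero2 f \<Longrightarrow> eventually_zero (f i)"
  unfolding eventually_zero2_def eventually_zero_def by meson

lemma eventually_zero2_col: "eventually_zero2 f \<Longrightarrow> eventually_zero (\<lambda>i. f i j)"
  unfolding eventually_zero2_def eventually_zero_def by meson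

lemma eventually_zero2_mono: "eventually_zero2 f \<Longrightarrow> (\<And>i j. f i j = 0 \<Longrightarrow> g i j = 0) \<Longrightarrow> eventually_zero2 g"
  unfolding eventually_zero2_def by meson

lemma eventually_zero2_Sum_any:
  fixes f :: "nat \<Rightarrow> nat \<Rightarrow> 'a::comm_monoid_add"
  assumes "eventually_zero2 f"
  shows "eventually_zero (\<lambda>i. Sum_any (f i))" 
proof -
  obtain N where N: "\<And>i j. i \<ge> N \<or> j \<ge> N \<Longrightarrow> f i j = 0" using assms by (auto simp: eventually_zero2_def)
  then have "Sum_any (f i) = 0" if "i \<ge> N" for i using that by simp
  then show ?thesis by (auto simp: eventually_zero_def)
qed

lemma Sum_any_swap:
  fixes f :: "nat \<Rightarrow> nat \<Rightarrow> 'a::comm_monoid_add"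
  assumes "eventually_zero2 f"
  shows "Sum_any (\<lambda>i. Sum_any (\<lambda>j. f i j)) = Sum_any (\<lambda>j. Sum_any (\<lambda>i. f i j))"
proof -
  obtain N where N: "\<And>i j. i \<ge> N \<or> j \<ge> N \<Longrightarrow> f i j = 0" using assms by (auto simp: eventually_zero2_def)
  then have "{a. \<exists>b. f a b \<noteq> 0} \<times> {b. \<exists>a. f a b \<noteq> 0} \<subseteq> {..<N} \<times> {..<N}"
    by (auto simp: not_le[symmetric])
  then show ?thesis by (intro Sum_any.swap[of "{..<N} \<times> {..<N}"]) auto
qed

text \<open>The square of side \<open>N\<close> containing the support lies in the triangle
  \<open>i + j < 2 N\<close>, which is summed along its antidiagonals.\<close>

lemma Sum_any_triangle:
  fixes f :: "nat \<Rightarrow> nat \<Rightarrow> 'a::comm_monoid_add"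
  assumes "eventually_zero2 f"
  shows "Sum_any (\<lambda>i. Sum_any (\<lambda>j. f i j)) = Sum_any (\<lambda>s. \<Sum>i\<le>s. f i (s - i))"
proof -
  obtain N where N: "\<And>i j. i \<ge> N \<or> j \<ge> N \<Longrightarrow> f i j = 0" using assms by (auto simp: eventually_zero2_def)
  have "Sum_any (f i) = sum (f i) {..<N}" for i by (rule Sum_any_lessThan) (use N in auto)
  moreover have "Sum_any (\<lambda>i. sum (f i) {..<N}) = (\<Sum>i<N. \<Sum>j<N. f i j)"
    by (rule Sum_any_lessThan) (use N in auto)
  ultimately have "Sum_any (\<lambda>i. Sum_any (\<lambda>j. f i j)) = (\<Sum>i<N. \<Sum>j<N. f i j)" by simp
  also have "\<dots> = (\<Sum>(i,j)\<in>{..<N}\<times>{..<N}. f i j)" by (rule sum.cartesian_product)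
  also have "\<dots> = (\<Sum>(i,j)\<in>{(i,j). i + j < N + N}. f i j)"
  proof (rule sum.mono_neutral_left)
    show "finite {(i::nat, j). i + j < N + N}"
      by (rule finite_subset[of _ "{..N+N} \<times> {..N+N}"]) auto
    show "\<forall>x\<in>{(i, j). i + j < N + N} - {..<N} \<times> {..<N}. (case x of (i, j) \<Rightarrow> f i j) = 0"
      using N by (auto simp: not_le[symmetric])
  qed auto
  also have "\<dots> = (\<Sum>s<N+N. \<Sum>i\<le>s. f i (s - i))" by (rule sum.triangle_reindex)
  also have "\<dots> = Sum_any (\<lambda>s. \<Sum>i\<le>s. f i (s - i))"
  proof (rule Sum_any_lessThan[symmetric], rule sum.neutral, intro ballI)
    fix s i assume "s \<ge> N + N" "i \<in> {..s}"
    then have "i \<ge> N \<or> s - i \<ge> N" by auto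
    then show "f i (s - i) = 0" by (rule N)
  qed
  finally show ?thesis .
qed

text \<open>Truncation provides the start of such an induction: a mode vanishes once its index is
  large.\<close>

lemma nat_down_induct:
  assumes "\<And>q. q \<ge> N \<Longrightarrow> P q" "\<And>q. (\<And>q'. q' > q \<Longrightarrow> P q') \<Longrightarrow> P (q::nat)"
  shows "P q"
proof (induction "N - q" arbitrary: q rule: less_induct)
  case less
  show ?case
  proof (cases "q \<ge> N")
    case False
    show ?thesis
      by (rule assms(2), rule less) (use False in simp)
  qed (rule assms(1))
qed

section \<open>Linear maps applied to sums\<close>

lemma linear_props:
  assumes "Vector_Spaces.linear s1 s2 f"
  shows linear_map_0: "f 0 = 0"
    and linear_map_add: "f (x + y) = f x + f y"
    and linear_map_diff: "f (x - y) = f x - f y"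
    and linear_map_scale: "f (s1 a x) = s2 a (f x)"
proof -
  interpret Vector_Spaces.linear s1 s2 f by fact
  show "f 0 = 0" "f (x + y) = f x + f y" "f (x - y) = f x - f y" "f (s1 a x) = s2 a (f x)"
    by (simp_all add: add diff scale)
qed

lemma linear_map_sum:
  assumes "Vector_Spaces.linear s1 s2 f"
  shows "f (sum g A) = (\<Sum>x\<in>A. f (g x))"
proof -
  interpret Vector_Spaces.linear s1 s2 f by fact
  show ?thesis by (rule sum)
qed

lemma linear_map_Sum_any:
  fixes g :: "nat \<Rightarrow> 'a::ab_group_add" and f :: "'a \<Rightarrow> 'b::ab_group_add"
  assumes f: "Vector_Spaces.linear s1 s2 f" and g: "eventually_zero g"
  shows "f (Sum_any g) = Sum_any (\<lambda>i. f (g i))"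
proof -
  obtain N where N: "\<And>i. i \<ge> N \<Longrightarrow> g i = 0" using g by (auto simp: eventually_zero_def)
  have "Sum_any g = sum g {..<N}" by (rule Sum_any_lessThan) (rule N)
  moreover have "Sum_any (\<lambda>i. f (g i)) = (\<Sum>i<N. f (g i))"
    by (rule Sum_any_lessThan) (simp add: N linear_map_0[OF f])
  ultimately show ?thesis by (simp add: linear_map_sum[OF f])
qed

context vector_space
begin

lemma scale_Sum_any: "eventually_zero g \<Longrightarrow> scale a (Sum_any g) = Sum_any (\<lambda>i::nat. scale a (g i))"
  by (rule linear_map_Sum_any[OF linear_scale_self])

end

section \<open>Binomial identities\<close>

lemma gchoose_Suc_add:
  fixes a :: complex
  shows "(a + 1) gchoose i = (a gchoose i) + (if i = 0 then 0 else a gchoose (i - 1))"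
  by (cases i) (auto simp: gbinomial_Suc_Suc)

text \<open>Regroups two nested summation indices: either \<open>i + j\<close> is chosen first and
  then split, or \<open>i\<close> is chosen first and then \<open>j\<close>.\<close>

lemma gchoose_trinomial:
  fixes a :: complex
  shows "(a gchoose (i + j)) * (of_nat (i + j) gchoose i) = (a gchoose i) * (a - of_nat i gchoose j)"
  using gbinomial_trinomial_revision[of i "i + j" a] by simp

text \<open>Pascal's rule, then a reindexing of the second sum. \<open>bsum_diff\<close> and
  \<open>jsum_diff\<close> use it to absorb one more factor \<open>x1 - x\<close>.\<close>

lemma Sum_any_pascal:
  fixes x :: complex and s :: "complex \<Rightarrow> 'c::ab_group_add \<Rightarrow> 'c"
  assumes vs: "vector_space s" and h: "eventually_zero h"
  shows "Sum_any (\<lambda>i. s (x + 1 gchoose i) (h i))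
    = Sum_any (\<lambda>i. s (x gchoose i) (h i)) + Sum_any (\<lambda>i. s (x gchoose i) (h (Suc i)))"
proof -
  interpret v: vector_space s by fact
  have e1: "eventually_zero (\<lambda>i. s (x gchoose i) (h i))" by (rule eventually_zero_mono[OF h]) simp
  have e2: "eventually_zero (\<lambda>i. if i = 0 then 0 else s (x gchoose (i - 1)) (h i))"
    by (rule eventually_zero_mono[OF h]) simp
  have "Sum_any (\<lambda>i. s (x + 1 gchoose i) (h i))
    = Sum_any (\<lambda>i. s (x gchoose i) (h i) + (if i = 0 then 0 else s (x gchoose (i - 1)) (h i)))"
    by (rule Sum_any.cong) (simp add: gchoose_Suc_add v.scale_left_distrib)
  also have "\<dots> = Sum_any (\<lambda>i. s (x gchoose i) (h i))
      + Sum_any (\<lambda>i. if i = 0 then 0 else s (x gchoose (i - 1)) (h i))"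
    by (rule Sum_any_add[OF e1 e2])
  also have "Sum_any (\<lambda>i. if i = 0 then 0 else s (x gchoose (i - 1)) (h i))
      = Sum_any (\<lambda>i. s (x gchoose i) (h (Suc i)))"
    by (subst Sum_any_Suc[OF e2]) simp
  finally show ?thesis .
qed

lemma gchoose_int_eq_0: "i > n \<Longrightarrow> of_int (int n) gchoose i = (0::complex)"
  by (simp add: binomial_gbinomial[symmetric])

section \<open>Weak modules\<close>

locale weak_V_module =
  fixes sV :: "complex \<Rightarrow> 'v::ab_group_add \<Rightarrow> 'v" and Y :: "'v \<Rightarrow> 'v \<Rightarrow> int \<Rightarrow> 'v" and vac :: 'v
    and sW :: "complex \<Rightarrow> 'w::ab_group_add \<Rightarrow> 'w" and YW :: "'v \<Rightarrow> 'w \<Rightarrow> int \<Rightarrow> 'w"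
  assumes weak_module: "weak_module sV Y vac sW YW"
begin

sublocale vector_space sW
  using weak_module by (simp add: weak_module_def)

lemma linear_left: "Vector_Spaces.linear sV sW (\<lambda>v. YW v w n)"
  and linear_right: "Vector_Spaces.linear sW sW (\<lambda>w. YW v w n)"
  using weak_module by (simp_all add: weak_module_def)

lemmas YW_simps [simp] = linear_map_0[OF linear_left] linear_map_0[OF linear_right]
lemmas YW_diff = linear_map_diff[OF linear_right]
lemmas YW_add = linear_map_add[OF linear_right]
lemmas YW_scale = linear_map_scale[OF linear_right]

lemma vac_mode: "YW vac w n = (if n = -1 then w else 0)"
  using weak_module by (simp add: weak_module_def)

lemma truncation: "\<exists>N::nat. \<forall>n\<ge>int N. YW v w n = 0"
proof -
  have "\<exists>N. \<forall>n\<ge>N. YW v w n = 0"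
    using weak_module unfolding weak_module_def by blast
  then obtain N where N: "\<And>n. n \<ge> N \<Longrightarrow> YW v w n = 0" by blast
  have "\<forall>n\<ge>int (nat N). YW v w n = 0" using N by simp
  then show ?thesis ..
qed

lemma eventually_zero_mode: "eventually_zero (\<lambda>i. YW v w (k + int i))"
proof -
  obtain N where N: "\<And>n. n \<ge> int N \<Longrightarrow> YW v w n = 0" using truncation by blast
  have "YW v w (k + int i) = 0" if "i \<ge> nat (int N - k)" for i
    by (rule N) (use that in linarith)
  then show ?thesis unfolding eventually_zero_def by blast
qed

lemma jacobi:
  "Sum_any (\<lambda>i::nat. sW (of_int m gchoose i) (YW (Y u v (l + int i)) w (m + n - int i)))
      = Sum_any (\<lambda>i::nat. sW ((-1) ^ i * (of_int l gchoose i))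
            (YW u (YW v w (n + int i)) (l + m - int i)
             - sW ((-1::complex) powi l) (YW v (YW u w (m + int i)) (l + n - int i))))"
  using weak_module unfolding weak_module_def jacobi_modes_def by blast

text \<open>In the second product \<open>u\<close> acts on \<open>w\<close> with modes of index
  \<open>m + i\<close>, all of which vanish.\<close>

lemma jacobi_truncated:
  assumes "\<And>k. k \<ge> m \<Longrightarrow> YW u w k = 0"
  shows "Sum_any (\<lambda>i::nat. sW (of_int m gchoose i) (YW (Y u v (l + int i)) w (m + n - int i)))
      = Sum_any (\<lambda>i::nat. sW ((-1) ^ i * (of_int l gchoose i)) (YW u (YW v w (n + int i)) (l + m - int i)))"
  by (simp add: jacobi assms)

text \<open>The Jacobi identity with \<open>l = k \<ge> 0\<close> and \<open>m\<close> large expresses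
  \<open>(a\<^sub>k b)\<^sub>n w\<close> through terms \<open>a\<^sub>j _\<close> with \<open>j \<ge> 0\<close> and terms \<open>(a\<^sub>k\<^sub>' b)\<^sub>n\<^sub>' w\<close>
  with \<open>k' > k\<close>; hence a downward induction on \<open>k\<close>.\<close>

lemma gpos_mode:
  assumes "v \<in> gpos sV Y" and V: "vector_space sV" and trV: "\<And>a b. \<exists>N::nat. \<forall>n\<ge>int N. Y a b n = 0"
  shows "YW v w n \<in> gpos sW YW"
proof -
  interpret V: vector_space sV by fact
  have base: "YW (Y a b (int k)) w n \<in> gpos sW YW" for a b k n
  proof -
    obtain N :: nat where N: "\<And>k. k \<ge> int N \<Longrightarrow> Y a b k = 0" using trV by blast
    obtain M :: nat where M: "\<And>k. k \<ge> int M \<Longrightarrow> YW a w k = 0" using truncation by blast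
    have "\<forall>n. YW (Y a b (int k)) w n \<in> gpos sW YW"
    proof (rule nat_down_induct[where N = N and P = "\<lambda>k. \<forall>n. YW (Y a b (int k)) w n \<in> gpos sW YW"])
      fix k assume IH: "\<And>k'. k' > k \<Longrightarrow> \<forall>n. YW (Y a b (int k')) w n \<in> gpos sW YW"
      show "\<forall>n. YW (Y a b (int k)) w n \<in> gpos sW YW"
      proof
        fix n
        \<comment> \<open>With \<open>n - int M\<close> as third parameter the term
          \<open>i = 0\<close> is exactly the mode \<open>n\<close> of \<open>a_k b\<close> on
          \<open>w\<close>.\<close>
        define L where "L = (\<lambda>i::nat. sW (of_int (int M) gchoose i)
          (YW (Y a b (int k + int i)) w (int M + (n - int M) - int i)))"
        have L0: "eventually_zero L" unfolding eventually_zero_def L_def by (rule exI[of _ N]) (simp add: N)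
        define R where "R = (\<lambda>i::nat. sW ((-1) ^ i * (of_int (int k) gchoose i))
            (YW a (YW b w (n - int M + int i)) (int k + int M - int i)))"
        have "Sum_any L = Sum_any R"
          unfolding L_def R_def by (rule jacobi_truncated) (rule M)
        \<comment> \<open>As the exponent \<open>k\<close> is nonnegative, its binomials end at
          \<open>i = k\<close>, so the outer mode index \<open>k + M - i\<close> stays
          nonnegative.\<close>
        also have "\<dots> = sum R {..<Suc k}"
          by (rule Sum_any_lessThan) (simp add: R_def gchoose_int_eq_0 del: of_int_of_nat_eq)
        also have "\<dots> \<in> gpos sW YW"
          unfolding gpos_def R_def
        proof (intro span_sum span_scale span_base)
          fix i assume "i \<in> {..<Suc k}"
          then have "int k + int M - int i \<ge> 0" by auto
          then show "YW a (YW b w (n - int M + int i)) (int k + int M - int i) \<in> {YW v w n |v w n. 0 \<le> n}"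
            by blast
        qed
        finally have 1: "L 0 + Sum_any (\<lambda>i. L (Suc i)) \<in> gpos sW YW"
          by (simp add: Sum_any_Suc[OF L0])
        have "Sum_any (\<lambda>i. L (Suc i)) = (\<Sum>i<N. L (Suc i))"
          by (rule Sum_any_lessThan) (simp add: L_def N)
        also have "\<dots> \<in> gpos sW YW"
          unfolding gpos_def L_def
        proof (intro span_sum span_scale)
          fix i
          show "YW (Y a b (int k + int (Suc i))) w (int M + (n - int M) - int (Suc i))
              \<in> span {YW v w n |v w n. 0 \<le> n}"
            using IH[of "k + Suc i"] unfolding gpos_def of_nat_add by simp
        qed
        finally have "L 0 \<in> gpos sW YW"
          using 1 span_add_eq2 unfolding gpos_def by blast
        then show "YW (Y a b (int k)) w n \<in> gpos sW YW" by (simp add: L_def)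
      qed
    qed (simp add: N gpos_def span_zero)
    then show ?thesis ..
  qed
  have "V.subspace {v. \<forall>n. YW v w n \<in> gpos sW YW}"
    unfolding V.subspace_def gpos_def
    by (auto simp: linear_map_add[OF linear_left] linear_map_scale[OF linear_left] 
      intro: span_zero span_add span_scale)
  moreover have "{Y v w n | v w n. n \<ge> 0} \<subseteq> {v. \<forall>n. YW v w n \<in> gpos sW YW}"
  proof safe
    fix a b and k n :: int assume "k \<ge> 0"
    with base[of a b "nat k" n] show "YW (Y a b k) w n \<in> gpos sW YW" by simp
  qed
  ultimately have "V.span {Y v w n | v w n. n \<ge> 0} \<subseteq> {v. \<forall>n. YW v w n \<in> gpos sW YW}"
    by (rule V.span_minimal[rotated])
  then have "v \<in> {v. \<forall>n. YW v w n \<in> gpos sW YW}"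
    using assms(1) unfolding gpos_def by blast
  then show ?thesis by simp
qed

text \<open>Apply \<open>gpos_mode\<close> to the vacuum, whose mode -1 is the identity.\<close>

lemma gpos_UNIV:
  assumes "gpos sV Y = UNIV" "weak_module sV Y vac sV Y"
  shows "gpos sW YW = UNIV"
proof -
  interpret V: weak_V_module sV Y vac sV Y by unfold_locales fact
  have "YW vac w (-1) \<in> gpos sW YW" for w
    by (rule gpos_mode) (use assms V.truncation V.vector_space_axioms in auto)
  then show ?thesis by (auto simp: vac_mode)
qed

end

section \<open>Homomorphisms\<close>

lemma gpos_hom_imp_V_hom:
  assumes V: "weak_module sV Y vac sV Y" and gpV: "gpos sV Y = UNIV"
    and M1: "weak_module sV Y vac s1 Y1" and M2: "weak_module sV Y vac s2 Y2"
    and hom: "gpos_hom s1 Y1 s2 Y2 f"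
  shows "V_hom s1 Y1 s2 Y2 f"
proof -
  interpret M1: weak_V_module sV Y vac s1 Y1 by unfold_locales fact
  interpret M2: weak_V_module sV Y vac s2 Y2 by unfold_locales fact
  have lin: "Vector_Spaces.linear s1 s2 f" and f_nonneg: "\<And>v w n. n \<ge> 0 \<Longrightarrow> f (Y1 v w n) = Y2 v (f w) n"
    using hom by (auto simp: gpos_hom_def)
  note [simp] = linear_map_0[OF lin] and f_simps = linear_map_diff[OF lin] linear_map_scale[OF lin]
  define D where "D a p w = f (Y1 a w p) - Y2 a (f w) p" for a p w
  \<comment> \<open>For \<open>m\<close> large and \<open>n \<ge> 0\<close> the Jacobi identity reads \<open>\<Sum>\<^sub>i (-1)\<^sup>i (l choose i) D a (l + m - i) (b\<^sub>n\<^sub>+\<^sub>i w) = 0\<close>.\<close>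
  have D0: "D a p (Y1 b w (int n)) = 0" for a b p w n
  proof -
    obtain N :: nat where N: "\<And>k. k \<ge> int N \<Longrightarrow> Y1 b w k = 0" using M1.truncation by blast
    obtain k1 :: nat where k1: "\<And>k. k \<ge> int k1 \<Longrightarrow> Y1 a w k = 0" using M1.truncation by blast
    obtain k2 :: nat where k2: "\<And>k. k \<ge> int k2 \<Longrightarrow> Y2 a (f w) k = 0" using M2.truncation by blast
    \<comment> \<open>A common truncation order for \<open>w\<close> and \<open>f w\<close> lets the
      Jacobi identities of both modules be truncated at the same \<open>m\<close>.\<close>
    define M where "M = max k1 k2"
    have M: "Y1 a w k = 0" "Y2 a (f w) k = 0" if "k \<ge> int M" for k
      using that k1 k2 by (auto simp: M_def)
    have "\<forall>p. D a p (Y1 b w (int n)) = 0"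
    proof (rule nat_down_induct[where N = N and P = "\<lambda>n. \<forall>p. D a p (Y1 b w (int n)) = 0"])
      fix n assume IH: "\<And>n'. n' > n \<Longrightarrow> \<forall>p. D a p (Y1 b w (int n')) = 0"
      show "\<forall>p. D a p (Y1 b w (int n)) = 0"
      proof
        fix p
        \<comment> \<open>Then the term \<open>i = 0\<close> carries the outer mode index
          \<open>l + M = p\<close>, and \<open>p\<close> is arbitrary.\<close>
        define l where "l = p - int M"
        define A1 where "A1 = (\<lambda>i::nat. s1 ((-1) ^ i * (of_int l gchoose i)) (Y1 a (Y1 b w (int n + int i)) (l + int M - int i)))"
        define A2 where "A2 = (\<lambda>i::nat. s2 ((-1) ^ i * (of_int l gchoose i)) (Y2 a (Y2 b (f w) (int n + int i)) (l + int M - int i)))"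
        define B1 where "B1 = (\<lambda>i::nat. s1 (of_int (int M) gchoose i) (Y1 (Y a b (l + int i)) w (int M + int n - int i)))"
        define B2 where "B2 = (\<lambda>i::nat. s2 (of_int (int M) gchoose i) (Y2 (Y a b (l + int i)) (f w) (int M + int n - int i)))"
        have evA1: "eventually_zero A1" unfolding A1_def
          by (rule eventually_zero_mono[OF M1.eventually_zero_mode[of b w "int n"]]) simp
        have evA2: "eventually_zero A2" unfolding A2_def
          by (rule eventually_zero_mono[OF M2.eventually_zero_mode[of b "f w" "int n"]]) simp
        have evB1: "eventually_zero B1" unfolding eventually_zero_def B1_def
          by (rule exI[of _ "Suc M"]) (simp add: gchoose_int_eq_0 del: of_int_of_nat_eq)
        \<comment> \<open>For \<open>i > M\<close> the binomial vanishes; for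
          \<open>i \<le> M\<close> the index \<open>M + n - i\<close> is nonnegative, so
          \<open>f\<close> commutes with the mode.\<close>
        have "f (B1 i) = B2 i" for i
          by (cases "i > M") (simp_all add: B1_def B2_def gchoose_int_eq_0 f_simps f_nonneg del: of_int_of_nat_eq)
        then have "f (Sum_any B1) = Sum_any B2"
          by (simp add: linear_map_Sum_any[OF lin evB1])
        moreover have "Sum_any B1 = Sum_any A1" "Sum_any B2 = Sum_any A2"
          unfolding A1_def A2_def B1_def B2_def
          by (rule M1.jacobi_truncated M2.jacobi_truncated, rule M, assumption)+
        ultimately have "Sum_any (\<lambda>i. f (A1 i)) - Sum_any A2 = 0"
          by (simp add: linear_map_Sum_any[OF lin evA1])
        moreover have "eventually_zero (\<lambda>i. f (A1 i))" by (rule eventually_zero_mono[OF evA1]) simp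
        ultimately have "Sum_any (\<lambda>i. f (A1 i) - A2 i) = 0"
          by (simp add: Sum_any_diff evA2)
        \<comment> \<open>The inner index \<open>n + i\<close> is nonnegative, so \<open>f\<close>
          passes through the inner mode and only the outer one leaves a discrepancy.\<close>
        moreover have "f (A1 i) - A2 i = s2 ((-1) ^ i * (of_int l gchoose i))
            (D a (l + int M - int i) (Y1 b w (int n + int i)))" for i
          by (simp add: A1_def A2_def D_def f_simps f_nonneg M2.scale_right_diff_distrib)
        moreover have "f (A1 i) - A2 i = (if i = 0 then D a p (Y1 b w (int n)) else 0)" for i
        proof (cases "i = 0")
          case False
          then show ?thesis using IH[of "n + i"] calculation(2)[of i] by simp
        qed (simp add: calculation(2) l_def)
        ultimately have "Sum_any (\<lambda>i. if i = (0::nat) then D a p (Y1 b w (int n)) else 0) = 0" by simp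
        then show "D a p (Y1 b w (int n)) = 0" by simp
      qed
    qed (simp add: N D_def)
    then show ?thesis ..
  qed
  have "M1.subspace {w. \<forall>a p. D a p w = 0}"
    unfolding M1.subspace_def D_def
    by (auto simp: M1.YW_add M2.YW_add linear_map_add[OF lin] f_simps M1.YW_scale M2.YW_scale)
  moreover have "D a p (Y1 b w n) = 0" if "n \<ge> 0" for a b p w n
    using D0[of a p b w "nat n"] that by simp
  then have "{Y1 v w n | v w n. n \<ge> 0} \<subseteq> {w. \<forall>a p. D a p w = 0}" by blast
  ultimately have "gpos s1 Y1 \<subseteq> {w. \<forall>a p. D a p w = 0}"
    unfolding gpos_def by (rule M1.span_minimal[rotated])
  then have "D a p w = 0" for a p w
    using M1.gpos_UNIV[OF gpV V] by blast
  then show ?thesis using lin by (simp add: V_hom_def D_def)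
qed

section \<open>Quasi-intertwining operators\<close>

text \<open>The two kinds of sums in the Jacobi identity: \<open>bsum\<close> is its left-hand side and
  \<open>jsum\<close> its right-hand side, where \<open>P p x\<close> and \<open>Q p x\<close> are the coefficients of the products
  of \<open>v\<close> and \<open>w\<^sub>1\<close> in the two orders.\<close>

definition bsum :: "(complex \<Rightarrow> 'a::ab_group_add \<Rightarrow> 'a) \<Rightarrow> (nat \<Rightarrow> complex \<Rightarrow> 'a) \<Rightarrow> int \<Rightarrow> complex \<Rightarrow> 'a" where
  "bsum s g k r = Sum_any (\<lambda>j. s (of_int k gchoose j) (g j (of_int k + r - of_nat j)))"

definition jsum :: "(complex \<Rightarrow> 'a::ab_group_add \<Rightarrow> 'a) \<Rightarrow> int \<Rightarrow> (int \<Rightarrow> complex \<Rightarrow> 'a)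
    \<Rightarrow> (int \<Rightarrow> complex \<Rightarrow> 'a) \<Rightarrow> int \<Rightarrow> complex \<Rightarrow> 'a" where
  "jsum s l P Q m r = Sum_any (\<lambda>i::nat. s ((-1) ^ i * (of_int l gchoose i))
      (P (l + m - int i) (r + of_nat i) - s ((-1) powi l) (Q (m + int i) (of_int l + r - of_nat i))))"

text \<open>At \<open>(k + 1, r)\<close> and \<open>(k, r + 1)\<close> each \<open>g j\<close> is
  taken at the same argument, so only the binomials differ. For modes of \<open>v\<close> on
  \<open>w1\<close>, a factor \<open>x1 - x\<close> thus raises the mode index by one.\<close>

lemma bsum_diff:
  assumes vs: "vector_space s" and g: "\<exists>J. \<forall>j\<ge>J. \<forall>x. g j x = 0"
  shows "bsum s g (k + 1) r - bsum s g k (r + 1) = bsum s (\<lambda>j. g (Suc j)) k r"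
proof -
  have ev: "eventually_zero (\<lambda>j. g j (of_int k + 1 + r - of_nat j))"
    using g unfolding eventually_zero_def by blast
  show ?thesis
    unfolding bsum_def using Sum_any_pascal[OF vs ev, of "of_int k"]
    by (simp add: algebra_simps)
qed

text \<open>Both products carry the factor \<open>(x1 - x)^l\<close>, expanded in nonnegative powers
  of \<open>x\<close> for \<open>P\<close> and of \<open>x1\<close> for \<open>Q\<close>. One more
  factor \<open>x1 - x\<close> raises \<open>l\<close> by one in both expansions.\<close>

lemma jsum_diff:
  assumes vs: "vector_space s"
    and P: "\<And>x. \<exists>N. \<forall>i\<ge>N. \<forall>p. P p (x + of_nat i) = 0"
    and Q: "\<And>k. \<exists>N. \<forall>i\<ge>N. \<forall>x. Q (k + int i) x = 0"
  shows "jsum s (l + 1) P Q m r = jsum s l P Q (m + 1) r - jsum s l P Q m (r + 1)"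
proof -
  interpret vector_space s by fact
  have split: "jsum s l P Q m r = Sum_any (\<lambda>i. s (of_int l gchoose i) (s ((-1) ^ i) (P (l + m - int i) (r + of_nat i))))
      - Sum_any (\<lambda>i. s (of_int l gchoose i) (s ((-1) ^ i * (-1) powi l) (Q (m + int i) (of_int l + r - of_nat i))))"
    for l m r
  proof -
    have "eventually_zero (\<lambda>i. s (of_int l gchoose i) (s ((-1) ^ i) (P (l + m - int i) (r + of_nat i))))"
      using P[of r] unfolding eventually_zero_def by (metis scale_zero_right)
    moreover have "eventually_zero (\<lambda>i. s (of_int l gchoose i) (s ((-1) ^ i * (-1) powi l) (Q (m + int i) (of_int l + r - of_nat i))))"
      using Q[of m] unfolding eventually_zero_def by (metis scale_zero_right)
    ultimately show ?thesis
      by (simp add: jsum_def Sum_any_diff[symmetric] scale_right_diff_distrib mult_ac)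
  qed
  have evP: "eventually_zero (\<lambda>i. s ((-1) ^ i) (P (l + 1 + m - int i) (r + of_nat i)))"
    using P[of r] unfolding eventually_zero_def by (metis scale_zero_right)
  have evQ: "eventually_zero (\<lambda>i. s ((-1) ^ i * (-1) powi (l + 1)) (Q (m + int i) (of_int l + 1 + r - of_nat i)))"
    using Q[of m] unfolding eventually_zero_def by (metis scale_zero_right)
  have neg: "(-1::complex) powi (1 + l) = - ((-1) powi l)"
    by (simp add: power_int_add)
  have neg_sum: "Sum_any (\<lambda>i::nat. - f i) = - Sum_any f" for f :: "nat \<Rightarrow> 'a"
    by (simp add: Sum_any.expand_set sum_negf)
  show ?thesis
    unfolding split
    using Sum_any_pascal[OF vs evP, of "of_int l"] Sum_any_pascal[OF vs evQ, of "of_int l"]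
    by (simp add: algebra_simps neg neg_sum)
qed

text \<open>A formal series in \<open>x\<^sub>1, x\<^sub>2, x\<close> is given by its coefficient function of \<open>(m, n, r)\<close>.
  Then \<open>D1\<close> is multiplication by \<open>x\<^sub>1 - x\<close> and \<open>D2\<close> multiplication by \<open>x\<^sub>2 - x\<close>.\<close>

definition D1 :: "(int \<Rightarrow> int \<Rightarrow> complex \<Rightarrow> 'a::ab_group_add) \<Rightarrow> int \<Rightarrow> int \<Rightarrow> complex \<Rightarrow> 'a" where
  "D1 F = (\<lambda>m n r. F (m + 1) n r - F m n (r + 1))"

definition D2 :: "(int \<Rightarrow> int \<Rightarrow> complex \<Rightarrow> 'a::ab_group_add) \<Rightarrow> int \<Rightarrow> int \<Rightarrow> complex \<Rightarrow> 'a" where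
  "D2 F = (\<lambda>m n r. F m (n + 1) r - F m n (r + 1))"

lemma D1_D2_commute: "D1 (D2 F) = D2 (D1 F)"
  by (simp add: D1_def D2_def fun_eq_iff)

lemma D1_funpow_D2: "(D1 ^^ p) (D2 F) = D2 ((D1 ^^ p) F)"
  by (induction p) (simp_all add: D1_D2_commute)

lemma funpow_D1_D2: "(D1 ^^ p) ((D2 ^^ q) F) = (D2 ^^ q) ((D1 ^^ p) F)"
  by (induction q) (simp_all add: D1_funpow_D2)

text \<open>\<open>D1\<close> never moves \<open>n\<close>, so knowing \<open>F\<close> on a single
  slice is enough; below, the slice \<open>n = 0\<close> is used.\<close>

lemma D1_funpow_eq:
  assumes "\<And>m r. F m n r = G 0 m r" "\<And>p m r. G (Suc p) m r = G p (m + 1) r - G p m (r + 1)"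
  shows "(D1 ^^ p) F m n r = G p m r"
  by (induction p arbitrary: m r) (simp_all add: assms D1_def)

lemma D2_funpow_eq:
  assumes "\<And>p. G (Suc p) = D2 (G p)"
  shows "(D2 ^^ p) (G 0) = G p"
  by (induction p) (simp_all add: assms)

lemma D2_funpow_diff: "(D2 ^^ q) (\<lambda>m n r. F m n r - G m n r) = (\<lambda>m n r. (D2 ^^ q) F m n r - (D2 ^^ q) G m n r)"
  by (induction q) (simp_all add: D2_def fun_eq_iff)

lemma D2_funpow_0: "(D2 ^^ q) (\<lambda>m n r. 0) = (\<lambda>m n r. 0)"
  by (induction q) (simp_all add: D2_def fun_eq_iff)

section \<open>Commutators of a quasi-intertwining operator with modes\<close>

locale quasi_intertwining_op =
  M1: weak_V_module sV Y vac s1 Y1 + M2: weak_V_module sV Y vac s2 Y2 + M3: weak_V_module sV Y vac s3 Y3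
  for sV :: "complex \<Rightarrow> 'v::ab_group_add \<Rightarrow> 'v" and Y :: "'v \<Rightarrow> 'v \<Rightarrow> int \<Rightarrow> 'v" and vac :: 'v
    and s1 :: "complex \<Rightarrow> 'w1::ab_group_add \<Rightarrow> 'w1" and Y1
    and s2 :: "complex \<Rightarrow> 'w2::ab_group_add \<Rightarrow> 'w2" and Y2
    and s3 :: "complex \<Rightarrow> 'w3::ab_group_add \<Rightarrow> 'w3" and Y3 +
  fixes om :: 'v and Yc :: "'w1 \<Rightarrow> 'w2 \<Rightarrow> complex \<Rightarrow> 'w3"
  assumes V: "weak_module sV Y vac sV Y"
    and quasi: "quasi_intertwining om s1 Y1 s2 Y2 s3 Y3 Yc"
begin

sublocale V: weak_V_module sV Y vac sV Y by unfold_locales (rule V)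

lemma linear_Yc_left: "Vector_Spaces.linear s1 s3 (\<lambda>w1. Yc w1 w2 n)"
  and linear_Yc_right: "Vector_Spaces.linear s2 s3 (\<lambda>w2. Yc w1 w2 n)"
  using quasi by (simp_all add: quasi_intertwining_def)

lemmas Yc_0 [simp] = linear_map_0[OF linear_Yc_left] linear_map_0[OF linear_Yc_right]

lemma eventually_zero_Yc: "eventually_zero (\<lambda>i. Yc w1 w2 (x + of_nat i))"
proof -
  have "\<exists>R::real. \<forall>n. Re n > R \<longrightarrow> Yc w1 w2 n = 0"
    using quasi unfolding quasi_intertwining_def by blast
  then obtain R :: real where R: "\<And>n. Re n > R \<Longrightarrow> Yc w1 w2 n = 0" by blast
  obtain N :: nat where N: "real N > R - Re x" using reals_Archimedean2 by blast
  have "Yc w1 w2 (x + of_nat i) = 0" if "i \<ge> N" for i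
    by (rule R) (use that N in simp)
  then show ?thesis unfolding eventually_zero_def by blast
qed

text \<open>The coefficients of \<open>(x\<^sub>1 - x)\<^sup>q [Y(c, x\<^sub>1), Yc(w\<^sub>1, x)] w\<close>, by the commutator formula.\<close>

definition K :: "'v \<Rightarrow> 'w1 \<Rightarrow> nat \<Rightarrow> 'w2 \<Rightarrow> int \<Rightarrow> complex \<Rightarrow> 'w3" where
  "K c w1 q w = bsum s3 (\<lambda>j. Yc (Y1 c w1 (int q + int j)) w)"

lemma K_0: "K c w1 0 w k r = Y3 c (Yc w1 w r) k - Yc w1 (Y2 c w k) r"
  using quasi unfolding quasi_intertwining_def K_def bsum_def by simp

lemma K_Suc: "K c w1 (Suc q) w k r = K c w1 q w (k + 1) r - K c w1 q w k (r + 1)"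
proof -
  obtain N :: nat where N: "\<And>k. k \<ge> int N \<Longrightarrow> Y1 c w1 k = 0" using M1.truncation by blast
  show ?thesis unfolding K_def
    by (subst bsum_diff[OF M3.vector_space_axioms]) (auto intro!: exI[of _ N] simp: N algebra_simps)
qed

text \<open>Locality: all modes in the sum have index at least \<open>q\<close>, so the power
  \<open>(x1 - x)^q\<close> annihilates the commutator.\<close>

lemma K_eq_0: "(\<And>k. k \<ge> int q \<Longrightarrow> Y1 c w1 k = 0) \<Longrightarrow> K c w1 q w k r = 0"
  by (simp add: K_def bsum_def)

lemma K_zero [simp]: "K 0 w1 q w k r = 0" "K c w1 q 0 k r = 0"
  by (simp_all add: K_def bsum_def)

lemma eventually_zero2_Yc:
  "eventually_zero2 (\<lambda>i j. Yc (Y1 c w1 (int q + int j)) w (of_int n + of_nat i + r - of_nat j))"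
proof (rule eventually_zero2I_right)
  obtain N :: nat where N: "\<And>k. k \<ge> int N \<Longrightarrow> Y1 c w1 k = 0" using M1.truncation by blast
  show "\<exists>J. \<forall>j\<ge>J. \<forall>i. Yc (Y1 c w1 (int q + int j)) w (of_int n + of_nat i + r - of_nat j) = 0"
    by (rule exI[of _ N]) (simp add: N)
  fix j show "eventually_zero (\<lambda>i. Yc (Y1 c w1 (int q + int j)) w (of_int n + of_nat i + r - of_nat j))"
    using eventually_zero_Yc[of "Y1 c w1 (int q + int j)" w "of_int n + r - of_nat j"]
    by (simp add: algebra_simps)
qed

lemma eventually_zero_K: "eventually_zero (\<lambda>i. K c w1 q w (n + int i) r)"
  unfolding K_def bsum_def
  by (rule eventually_zero2_Sum_any, rule eventually_zero2_mono[OF eventually_zero2_Yc[of c w1 q w n r]]) simp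

context
  fixes a b :: 'v and w1 :: 'w1 and w2 :: 'w2 and l :: int
begin

text \<open>Computing \<open>[Y(Y(a, x\<^sub>0) b, x\<^sub>2), Yc(w\<^sub>1, x)]\<close> directly gives \<open>H\<close>; expanding \<open>Y(a, x\<^sub>0) b\<close> by
  the Jacobi identities of the second and third module first gives \<open>T + Z\<close>, where \<open>T\<close> collects the
  commutators with \<open>b\<close> and \<open>Z\<close> those with \<open>a\<close>. A high power of \<open>x\<^sub>1 - x\<close> kills \<open>Z\<close>. The index \<open>q\<close>
  of \<open>H\<close> and \<open>T\<close> is a factor \<open>(x\<^sub>2 - x)\<^sup>q\<close>, the index \<open>p\<close> of \<open>Z\<close> a factor \<open>(x\<^sub>1 - x)\<^sup>p\<close>.\<close>

definition H :: "nat \<Rightarrow> int \<Rightarrow> int \<Rightarrow> complex \<Rightarrow> 'w3" where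
  "H q m n r = Sum_any (\<lambda>i. s3 (of_int m gchoose i) (K (Y a b (l + int i)) w1 q w2 (m + n - int i) r))"

definition T :: "nat \<Rightarrow> int \<Rightarrow> int \<Rightarrow> complex \<Rightarrow> 'w3" where
  "T q m n r = Sum_any (\<lambda>i. s3 ((-1) ^ i * (of_int l gchoose i))
     (Y3 a (K b w1 q w2 (n + int i) r) (l + m - int i)
      - s3 ((-1) powi l) (K b w1 q (Y2 a w2 (m + int i)) (l + n - int i) r)))"

definition Z :: "nat \<Rightarrow> int \<Rightarrow> int \<Rightarrow> complex \<Rightarrow> 'w3" where
  "Z p m n r = Sum_any (\<lambda>i. s3 ((-1) ^ i * (of_int l gchoose i))
     (K a w1 p (Y2 b w2 (n + int i)) (l + m - int i) r
      - s3 ((-1) powi l) (Y3 b (K a w1 p w2 (m + int i) r) (l + n - int i))))"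

lemma eventually_zero_H: "eventually_zero (\<lambda>i. s3 (of_int m gchoose i) (K (Y a b (l + int i)) w1 q w2 (k - int i) r))"
  by (rule eventually_zero_mono[OF V.eventually_zero_mode[of a b l]]) simp

lemma eventually_zero_T: "eventually_zero (\<lambda>i. s3 ((-1) ^ i * (of_int l gchoose i))
     (Y3 a (K b w1 q w2 (n + int i) r) (k - int i)
      - s3 ((-1) powi l) (K b w1 q (Y2 a w2 (m + int i)) (k' - int i) r)))"
  by (rule eventually_zero_mono2[OF eventually_zero_K[of b w1 q w2 n r] M2.eventually_zero_mode[of a w2 m]]) simp

lemma eventually_zero_Z: "eventually_zero (\<lambda>i. s3 ((-1) ^ i * (of_int l gchoose i))
     (K a w1 p (Y2 b w2 (n + int i)) (k - int i) r
      - s3 ((-1) powi l) (Y3 b (K a w1 p w2 (m + int i) r) (k' - int i))))"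
  by (rule eventually_zero_mono2[OF eventually_zero_K[of a w1 p w2 m r] M2.eventually_zero_mode[of b w2 n]]) simp

lemma H_Suc: "H (Suc q) = D2 (H q)"
  unfolding fun_eq_iff D2_def H_def
  by (subst Sum_any_diff[OF eventually_zero_H eventually_zero_H, symmetric])
    (simp add: K_Suc M3.scale_right_diff_distrib algebra_simps)

lemma T_Suc: "T (Suc q) = D2 (T q)"
  unfolding fun_eq_iff D2_def T_def
  by (subst Sum_any_diff[OF eventually_zero_T eventually_zero_T, symmetric])
    (simp add: K_Suc M3.scale_right_diff_distrib M3.YW_diff algebra_simps)

lemma Z_Suc: "Z (Suc q) m n r = Z q (m + 1) n r - Z q m n (r + 1)"
  unfolding Z_def
  by (subst Sum_any_diff[OF eventually_zero_Z eventually_zero_Z, symmetric])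
    (simp add: K_Suc M3.scale_right_diff_distrib M3.YW_diff algebra_simps)

text \<open>For \<open>q = 0\<close> the coefficients \<open>K\<close> are actual commutators. After
  the Jacobi identities in the second and third modules, each product of modes obeys the Leibniz
  rule \<open>[a b, phi] = a [b, phi] + [a, phi] b\<close>.\<close>

lemma H_0_eq: "H 0 m n r = T 0 m n r + Z 0 m n r"
proof -
  let ?c = "\<lambda>i::nat. (-1) ^ i * (of_int l gchoose i) :: complex"
  let ?s = "(-1) powi l :: complex"
  have ev3: "eventually_zero (\<lambda>i. s3 (of_int m gchoose i) (Y3 (Y a b (l + int i)) w (m + n - int i)))" for w
    by (rule eventually_zero_mono[OF V.eventually_zero_mode[of a b l]]) simp
  have ev2: "eventually_zero (\<lambda>i. s2 (of_int m gchoose i) (Y2 (Y a b (l + int i)) w2 (m + n - int i)))"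
    by (rule eventually_zero_mono[OF V.eventually_zero_mode[of a b l]]) simp
  have ev2': "eventually_zero (\<lambda>i. s3 (of_int m gchoose i) (Yc w1 (Y2 (Y a b (l + int i)) w2 (m + n - int i)) r))"
    by (rule eventually_zero_mono[OF V.eventually_zero_mode[of a b l]]) simp
  define R2 where "R2 = (\<lambda>i. s2 (?c i) (Y2 a (Y2 b w2 (n + int i)) (l + m - int i)
             - s2 ?s (Y2 b (Y2 a w2 (m + int i)) (l + n - int i))))"
  define R3 where "R3 = (\<lambda>i. s3 (?c i) (Y3 a (Y3 b (Yc w1 w2 r) (n + int i)) (l + m - int i)
             - s3 ?s (Y3 b (Y3 a (Yc w1 w2 r) (m + int i)) (l + n - int i))))"
  have evR2: "eventually_zero R2" unfolding R2_def
    by (rule eventually_zero_mono2[OF M2.eventually_zero_mode[of a w2 m] M2.eventually_zero_mode[of b w2 n]]) simp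
  have evR3: "eventually_zero R3" unfolding R3_def
    by (rule eventually_zero_mono2[OF M3.eventually_zero_mode[of a "Yc w1 w2 r" m] M3.eventually_zero_mode[of b "Yc w1 w2 r" n]]) simp
  have evR2': "eventually_zero (\<lambda>i. Yc w1 (R2 i) r)" by (rule eventually_zero_mono[OF evR2]) simp
  have "H 0 m n r = Sum_any (\<lambda>i. s3 (of_int m gchoose i) (Y3 (Y a b (l + int i)) (Yc w1 w2 r) (m + n - int i)))
     - Sum_any (\<lambda>i. s3 (of_int m gchoose i) (Yc w1 (Y2 (Y a b (l + int i)) w2 (m + n - int i)) r))"
    unfolding H_def Sum_any_diff[OF ev3 ev2', symmetric]
    by (simp add: K_0 M3.scale_right_diff_distrib)
  also have "Sum_any (\<lambda>i. s3 (of_int m gchoose i) (Yc w1 (Y2 (Y a b (l + int i)) w2 (m + n - int i)) r))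
     = Yc w1 (Sum_any (\<lambda>i. s2 (of_int m gchoose i) (Y2 (Y a b (l + int i)) w2 (m + n - int i)))) r"
    by (simp add: linear_map_Sum_any[OF linear_Yc_right ev2] linear_map_scale[OF linear_Yc_right])
  also have "Sum_any (\<lambda>i. s2 (of_int m gchoose i) (Y2 (Y a b (l + int i)) w2 (m + n - int i))) = Sum_any R2"
    unfolding R2_def by (rule M2.jacobi)
  also have "Sum_any (\<lambda>i. s3 (of_int m gchoose i) (Y3 (Y a b (l + int i)) (Yc w1 w2 r) (m + n - int i))) = Sum_any R3"
    unfolding R3_def by (rule M3.jacobi)
  also have "Yc w1 (Sum_any R2) r = Sum_any (\<lambda>i. Yc w1 (R2 i) r)"
    by (rule linear_map_Sum_any[OF linear_Yc_right evR2])
  also have "Sum_any R3 - Sum_any (\<lambda>i. Yc w1 (R2 i) r) = Sum_any (\<lambda>i. R3 i - Yc w1 (R2 i) r)"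
    by (simp add: Sum_any_diff evR3 evR2')
  also have "\<dots> = T 0 m n r + Z 0 m n r"
    unfolding T_def Z_def Sum_any_add[OF eventually_zero_T eventually_zero_Z, symmetric]
    by (rule Sum_any.cong)
      (simp add: R2_def R3_def K_0 M3.scale_right_diff_distrib M3.scale_right_distrib M3.YW_diff
        linear_map_scale[OF linear_Yc_right] linear_map_diff[OF linear_Yc_right] algebra_simps)
  finally show ?thesis .
qed


text \<open>Terms are collected by \<open>s = i + j\<close>. The trinomial identity replaces the
  binomials by one in \<open>(m, s)\<close> and one in \<open>(s, i)\<close>, and the inner sum
  becomes the left side of a Jacobi identity on the first module.\<close>

lemma H_n0:
  "H q m 0 r = bsum s3 (\<lambda>s. Yc (Sum_any (\<lambda>i. s1 (of_int (int s) gchoose i)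
      (Y1 (Y a b (l + int i)) w1 (int s + int q - int i)))) w2) m r"
proof -
  define f where "f = (\<lambda>i j. s3 ((of_int m gchoose i) * (of_int m - of_nat i gchoose j))
    (Yc (Y1 (Y a b (l + int i)) w1 (int q + int j)) w2 (of_int m + r - of_nat (i + j))))"
  have ev: "eventually_zero2 f"
  proof (rule eventually_zero2I_left)
    obtain N :: nat where N: "\<And>k. k \<ge> int N \<Longrightarrow> Y a b k = 0" using V.truncation by blast
    show "\<exists>J. \<forall>i\<ge>J. \<forall>j. f i j = 0"
      by (rule exI[of _ "nat (int N - l)"]) (auto simp: f_def N)
    show "eventually_zero (f i)" for i
      unfolding f_def by (rule eventually_zero_mono[OF M1.eventually_zero_mode[of "Y a b (l + int i)" w1 "int q"]]) simp
  qed
  have "H q m 0 r = Sum_any (\<lambda>i. Sum_any (f i))"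
    unfolding H_def
  proof (rule Sum_any.cong)
    fix i
    have "eventually_zero (\<lambda>j. s3 (of_int (m - int i) gchoose j) (Yc (Y1 (Y a b (l + int i)) w1 (int q + int j)) w2
         (of_int (m - int i) + r - of_nat j)))"
      by (rule eventually_zero_mono[OF M1.eventually_zero_mode[of "Y a b (l + int i)" w1 "int q"]]) simp
    then show "s3 (of_int m gchoose i) (K (Y a b (l + int i)) w1 q w2 (m + 0 - int i) r) = Sum_any (f i)"
      by (simp add: K_def bsum_def M3.scale_Sum_any f_def algebra_simps)
  qed
  also have "\<dots> = Sum_any (\<lambda>s. \<Sum>i\<le>s. f i (s - i))"
    by (rule Sum_any_triangle[OF ev])
  also have "\<dots> = bsum s3 (\<lambda>s. Yc (Sum_any (\<lambda>i. s1 (of_int (int s) gchoose i)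
      (Y1 (Y a b (l + int i)) w1 (int s + int q - int i)))) w2) m r"
    unfolding bsum_def
  proof (rule Sum_any.cong)
    fix s
    have "Sum_any (\<lambda>i. s1 (of_int (int s) gchoose i) (Y1 (Y a b (l + int i)) w1 (int s + int q - int i)))
      = (\<Sum>i<Suc s. s1 (of_int (int s) gchoose i) (Y1 (Y a b (l + int i)) w1 (int s + int q - int i)))"
      by (rule Sum_any_lessThan) (simp add: gchoose_int_eq_0 del: of_int_of_nat_eq)
    also have "{..<Suc s} = {..s}" by auto
    finally have "s3 (of_int m gchoose s) (Yc (Sum_any (\<lambda>i. s1 (of_int (int s) gchoose i)
        (Y1 (Y a b (l + int i)) w1 (int s + int q - int i)))) w2 (of_int m + r - of_nat s))
      = (\<Sum>i\<le>s. s3 ((of_int m gchoose s) * (of_nat s gchoose i))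
        (Yc (Y1 (Y a b (l + int i)) w1 (int s + int q - int i)) w2 (of_int m + r - of_nat s)))"
      by (simp add: linear_map_sum[OF linear_Yc_left] linear_map_scale[OF linear_Yc_left] M3.scale_sum_right)
    also have "\<dots> = (\<Sum>i\<le>s. f i (s - i))"
    proof (rule sum.cong)
      fix i assume "i \<in> {..s}"
      then obtain j where s: "s = i + j" by (auto simp: le_iff_add)
      show "s3 ((of_int m gchoose s) * (of_nat s gchoose i))
        (Yc (Y1 (Y a b (l + int i)) w1 (int s + int q - int i)) w2 (of_int m + r - of_nat s)) = f i (s - i)"
        unfolding s f_def gchoose_trinomial by (simp add: add.commute)
    qed simp
    finally show "(\<Sum>i\<le>s. f i (s - i)) = s3 (of_int m gchoose s) (Yc (Sum_any (\<lambda>i. s1 (of_int (int s) gchoose i)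
        (Y1 (Y a b (l + int i)) w1 (int s + int q - int i)))) w2 (of_int m + r - of_nat s))" ..
  qed
  finally show ?thesis .
qed

text \<open>This is the expansion of \<open>(x1 - x2)^l\<close> in powers of
  \<open>(x1 - x)^(l - j) (x2 - x)^j\<close>. Taking the residue in \<open>x2\<close> turns
  \<open>(x2 - x)^(q + j)\<close> times the commutator with \<open>b\<close> into the operator of
  \<open>b_(q + j) w1\<close>.\<close>

lemma T_n0:
  "T q m 0 r = Sum_any (\<lambda>j. s3 ((-1) ^ j * (of_int l gchoose j))
     (jsum s3 (l - int j) (\<lambda>x s. Y3 a (Yc (Y1 b w1 (int q + int j)) w2 s) x)
        (\<lambda>x s. Yc (Y1 b w1 (int q + int j)) (Y2 a w2 x) s) m r))"
proof -
  define u where "u = (\<lambda>j. Y1 b w1 (int q + int j))"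
  define f1 where "f1 = (\<lambda>i j. s3 ((-1) ^ i * (of_int l gchoose i) * (of_nat i gchoose j))
     (Y3 a (Yc (u j) w2 (of_nat i + r - of_nat j)) (l + m - int i)))"
  define f2 where "f2 = (\<lambda>i j. s3 ((-1) ^ i * (of_int l gchoose i) * (-1) powi l * (of_int l - of_nat i gchoose j))
     (Yc (u j) (Y2 a w2 (m + int i)) (of_int l - of_nat i + r - of_nat j)))"
  obtain N :: nat where N: "\<And>j. j \<ge> N \<Longrightarrow> u j = 0"
    using M1.eventually_zero_mode[of b w1 "int q"] by (auto simp: eventually_zero_def u_def)
  have ev1: "eventually_zero2 f1"
    by (rule eventually_zero2_mono[OF eventually_zero2_Yc[of b w1 q w2 0 r]]) (simp add: f1_def u_def)
  have ev2: "eventually_zero2 f2"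
  proof (rule eventually_zero2I_right)
    show "\<exists>J. \<forall>j\<ge>J. \<forall>i. f2 i j = 0"
      by (rule exI[of _ N]) (simp add: f2_def N)
    show "eventually_zero (\<lambda>i. f2 i j)" for j
      unfolding f2_def by (rule eventually_zero_mono[OF M2.eventually_zero_mode[of a w2 m]]) simp
  qed
  have "T q m 0 r = Sum_any (\<lambda>i. Sum_any (f1 i) - Sum_any (f2 i))"
    unfolding T_def
  proof (rule Sum_any.cong)
    fix i
    have K_eq: "K b w1 q w k r = Sum_any (\<lambda>j. s3 (of_int k gchoose j) (Yc (u j) w (of_int k + r - of_nat j)))" for w k r
      by (simp add: K_def bsum_def u_def)
    have ev: "eventually_zero (\<lambda>j. s3 (c j) (Yc (u j) w (x j)))" for c w x
      unfolding eventually_zero_def by (rule exI[of _ N]) (simp add: N)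
    have ev': "eventually_zero (\<lambda>j. s3 (c j) (Y3 a (Yc (u j) w (x j)) k))" for c w x k
      unfolding eventually_zero_def by (rule exI[of _ N]) (simp add: N)
    have "s3 ((-1) ^ i * (of_int l gchoose i)) (Y3 a (K b w1 q w2 (0 + int i) r) (l + m - int i)) = Sum_any (f1 i)"
      unfolding K_eq linear_map_Sum_any[OF M3.linear_right ev] M3.YW_scale M3.scale_Sum_any[OF ev']
      by (simp add: f1_def)
    moreover have "s3 ((-1) ^ i * (of_int l gchoose i)) (s3 ((-1) powi l) (K b w1 q (Y2 a w2 (m + int i)) (l + 0 - int i) r))
        = Sum_any (f2 i)"
      unfolding K_eq M3.scale_scale M3.scale_Sum_any[OF ev] by (simp add: f2_def mult.assoc)
    ultimately show "s3 ((-1) ^ i * (of_int l gchoose i))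
       (Y3 a (K b w1 q w2 (0 + int i) r) (l + m - int i)
        - s3 ((-1) powi l) (K b w1 q (Y2 a w2 (m + int i)) (l + 0 - int i) r)) = Sum_any (f1 i) - Sum_any (f2 i)"
      by (simp only: M3.scale_right_diff_distrib)
  qed
  also have "\<dots> = Sum_any (\<lambda>i. Sum_any (f1 i)) - Sum_any (\<lambda>i. Sum_any (f2 i))"
    by (rule Sum_any_diff[OF eventually_zero2_Sum_any[OF ev1] eventually_zero2_Sum_any[OF ev2]])
  also have "\<dots> = Sum_any (\<lambda>j. Sum_any (\<lambda>i. f1 i j)) - Sum_any (\<lambda>j. Sum_any (\<lambda>i. f2 i j))"
    by (simp only: Sum_any_swap[OF ev1] Sum_any_swap[OF ev2])
  also have "\<dots> = Sum_any (\<lambda>j. Sum_any (\<lambda>i. f1 i j) - Sum_any (\<lambda>i. f2 i j))"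
    by (rule Sum_any_diff[OF eventually_zero2_Sum_any[OF eventually_zero2_flip[OF ev1]] eventually_zero2_Sum_any[OF eventually_zero2_flip[OF ev2]], symmetric])
  also have "\<dots> = Sum_any (\<lambda>j. s3 ((-1) ^ j * (of_int l gchoose j))
     (jsum s3 (l - int j) (\<lambda>x s. Y3 a (Yc (u j) w2 s) x) (\<lambda>x s. Yc (u j) (Y2 a w2 x) s) m r))"
  proof (rule Sum_any.cong)
    fix j
    \<comment> \<open>The coefficient contains \<open>i choose j\<close>, which vanishes for
      \<open>i < j\<close>.\<close>
    have "Sum_any (\<lambda>i. f1 i j) = Sum_any (\<lambda>i. f1 (j + i) j)"
      by (rule Sum_any_shift[OF eventually_zero2_col[OF ev1]]) (simp add: f1_def binomial_gbinomial[symmetric])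
    then have "Sum_any (\<lambda>i. f1 i j) - Sum_any (\<lambda>i. f2 i j) = Sum_any (\<lambda>i. f1 (j + i) j - f2 i j)"
      by (simp add: Sum_any_diff[OF eventually_zero_shift[OF eventually_zero2_col[OF ev1]] eventually_zero2_col[OF ev2]])
    also have "\<dots> = Sum_any (\<lambda>i. s3 ((-1) ^ j * (of_int l gchoose j)) (s3 ((-1) ^ i * (of_int (l - int j) gchoose i))
        (Y3 a (Yc (u j) w2 (r + of_nat i)) (l - int j + m - int i)
         - s3 ((-1) powi (l - int j)) (Yc (u j) (Y2 a w2 (m + int i)) (of_int (l - int j) + r - of_nat i)))))"
    proof (rule Sum_any.cong)
      fix i
      have 1: "(of_int l gchoose (j + i)) * (of_nat (j + i) gchoose j)
          = (of_int l gchoose j) * (of_int l - of_nat j gchoose i :: complex)"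
        by (rule gchoose_trinomial)
      \<comment> \<open>In the second product the roles of \<open>i\<close> and \<open>j\<close> are
        exchanged, so that both products share the factor \<open>l choose j\<close>.\<close>
      have "(of_int l gchoose i) * (of_int l - of_nat i gchoose j :: complex)
          = (of_int l gchoose (i + j)) * (of_nat (i + j) gchoose i)"
        by (rule gchoose_trinomial[symmetric])
      also have "(of_nat (i + j) gchoose i :: complex) = of_nat (j + i) gchoose j"
        unfolding binomial_gbinomial[symmetric] using binomial_symmetric[of i "i + j"] by (simp add: add.commute)
      finally have 2: "(of_int l gchoose i) * (of_int l - of_nat i gchoose j :: complex)
          = (of_int l gchoose j) * (of_int l - of_nat j gchoose i)" using 1 by (simp add: add.commute)
      have 3: "(-1::complex) powi l = (-1) ^ j * (-1) powi (l - int j)"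
        by (simp add: power_int_diff)
      have c1: "(-1) ^ (j + i) * (of_int l gchoose (j + i)) * (of_nat (j + i) gchoose j)
        = (-1) ^ j * (of_int l gchoose j) * ((-1) ^ i * (of_int (l - int j) gchoose i) :: complex)"
        using 1 by (simp add: power_add mult_ac)
      have c2: "(-1) ^ i * (of_int l gchoose i) * (-1) powi l * (of_int l - of_nat i gchoose j)
        = (-1) ^ j * (of_int l gchoose j) * ((-1) ^ i * (of_int (l - int j) gchoose i) * (-1) powi (l - int j) :: complex)"
        unfolding 3 using 2 by (simp add: mult_ac)
      show "f1 (j + i) j - f2 i j = s3 ((-1) ^ j * (of_int l gchoose j)) (s3 ((-1) ^ i * (of_int (l - int j) gchoose i))
        (Y3 a (Yc (u j) w2 (r + of_nat i)) (l - int j + m - int i)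
         - s3 ((-1) powi (l - int j)) (Yc (u j) (Y2 a w2 (m + int i)) (of_int (l - int j) + r - of_nat i))))"
        unfolding f1_def f2_def c1 c2
        by (simp add: M3.scale_right_diff_distrib algebra_simps)
    qed
    also have "\<dots> = s3 ((-1) ^ j * (of_int l gchoose j))
     (jsum s3 (l - int j) (\<lambda>x s. Y3 a (Yc (u j) w2 s) x) (\<lambda>x s. Yc (u j) (Y2 a w2 x) s) m r)"
      unfolding jsum_def
      by (rule M3.scale_Sum_any[symmetric], rule eventually_zero_mono2[OF eventually_zero_Yc[of "u j" w2 r] M2.eventually_zero_mode[of a w2 m]]) simp
    finally show "Sum_any (\<lambda>i. f1 i j) - Sum_any (\<lambda>i. f2 i j) = s3 ((-1) ^ j * (of_int l gchoose j))
     (jsum s3 (l - int j) (\<lambda>x s. Y3 a (Yc (u j) w2 s) x) (\<lambda>x s. Yc (u j) (Y2 a w2 x) s) m r)" .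
  qed
  finally show ?thesis unfolding u_def .
qed


text \<open>Multiplying \<open>H = T + Z\<close> by \<open>(x1 - x)^p (x2 - x)^q\<close> removes
  \<open>Z\<close>; the slice \<open>n = 0\<close> of what remains is a relation among the Jacobi
  identities for the vectors \<open>b_(q + j) w1\<close>.\<close>

lemma jacobi_sum_identity:
  fixes q p :: nat
  assumes p: "\<And>k. k \<ge> int p \<Longrightarrow> Y1 a w1 k = 0"
  shows "Sum_any (\<lambda>j. s3 ((-1) ^ j * (of_int l gchoose j))
     (bsum s3 (\<lambda>i. Yc (Y1 a (Y1 b w1 (int q + int j)) (l + int p - int j + int i)) w2) m r))
   = Sum_any (\<lambda>j. s3 ((-1) ^ j * (of_int l gchoose j))
     (jsum s3 (l + int p - int j) (\<lambda>x s. Y3 a (Yc (Y1 b w1 (int q + int j)) w2 s) x)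
        (\<lambda>x s. Yc (Y1 b w1 (int q + int j)) (Y2 a w2 x) s) m r))"
proof -
  define u where "u = (\<lambda>j. Y1 b w1 (int q + int j))"
  obtain N :: nat where N: "\<And>j. j \<ge> N \<Longrightarrow> u j = 0"
    using M1.eventually_zero_mode[of b w1 "int q"] by (auto simp: eventually_zero_def u_def)
  define h where "h = (\<lambda>s. Sum_any (\<lambda>i. s1 (of_int (int s) gchoose i)
      (Y1 (Y a b (l + int i)) w1 (int s + int q - int i))))"
  define g where "g = (\<lambda>s j. s1 ((-1) ^ j * (of_int l gchoose j)) (Y1 a (u j) (l + int s - int j)))"
  have evg: "eventually_zero2 g"
  proof (rule eventually_zero2I_right)
    show "\<exists>J. \<forall>j\<ge>J. \<forall>i. g i j = 0" by (rule exI[of _ N]) (simp add: N g_def)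
    show "eventually_zero (\<lambda>i. g i j)" for j
      unfolding g_def
      by (rule eventually_zero_mono[OF M1.eventually_zero_mode[of a "u j" "l - int j"]]) (simp add: algebra_simps)
  qed
  \<comment> \<open>For \<open>s \<ge> p\<close> the modes of \<open>a\<close> on \<open>w1\<close>
    from index \<open>s\<close> on vanish, so the Jacobi identity on the first module has only one
    product.\<close>
  have h_g: "h s = Sum_any (g s)" if "s \<ge> p" for s
    unfolding h_def g_def u_def by (rule M1.jacobi_truncated) (use p that in simp)
  obtain N' where "\<forall>s\<ge>N'. Sum_any (g s) = 0"
    using eventually_zero2_Sum_any[OF evg] by (auto simp: eventually_zero_def)
  then have h0: "h s = 0" if "s \<ge> max p N'" for s
    using that h_g by simp
  \<comment> \<open>A factor \<open>(x1 - x)^k\<close> shifts the argument of \<open>h\<close> by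
    \<open>k\<close>; at \<open>k = p\<close> only arguments covered by \<open>h_g\<close>
    remain.\<close>
  define G where "G = (\<lambda>k. bsum s3 (\<lambda>s. Yc (h (k + s)) w2))"
  define U where "U = (\<lambda>k m r. Sum_any (\<lambda>j. s3 ((-1) ^ j * (of_int l gchoose j))
     (jsum s3 (l + int k - int j) (\<lambda>x s. Y3 a (Yc (u j) w2 s) x) (\<lambda>x s. Yc (u j) (Y2 a w2 x) s) m r)))"
  have G_Suc: "G (Suc k) m r = G k (m + 1) r - G k m (r + 1)" for k m r
  proof -
    have "\<exists>J. \<forall>j\<ge>J. \<forall>x. Yc (h (k + j)) w2 x = 0"
      by (rule exI[of _ "max p N'"]) (simp add: h0)
    from bsum_diff[OF M3.vector_space_axioms this] show ?thesis
      unfolding G_def by simp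
  qed
  have evU: "eventually_zero (\<lambda>j. s3 ((-1) ^ j * (of_int l gchoose j))
     (jsum s3 (l' + int k - int j) (\<lambda>x s. Y3 a (Yc (u j) w2 s) x) (\<lambda>x s. Yc (u j) (Y2 a w2 x) s) m r))" for l' k m r
    unfolding eventually_zero_def by (rule exI[of _ N]) (simp add: N jsum_def)
  have U_Suc: "U (Suc k) m r = U k (m + 1) r - U k m (r + 1)" for k m r
  proof -
    have "jsum s3 (l' + 1) (\<lambda>x s. Y3 a (Yc (u j) w2 s) x) (\<lambda>x s. Yc (u j) (Y2 a w2 x) s) m r
       = jsum s3 l' (\<lambda>x s. Y3 a (Yc (u j) w2 s) x) (\<lambda>x s. Yc (u j) (Y2 a w2 x) s) (m + 1) r
       - jsum s3 l' (\<lambda>x s. Y3 a (Yc (u j) w2 s) x) (\<lambda>x s. Yc (u j) (Y2 a w2 x) s) m (r + 1)" for l' j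
    proof (rule jsum_diff[OF M3.vector_space_axioms])
      fix x k
      show "\<exists>N. \<forall>i\<ge>N. \<forall>p. Y3 a (Yc (u j) w2 (x + of_nat i)) p = 0"
        using eventually_zero_Yc[of "u j" w2 x] unfolding eventually_zero_def by (metis M3.YW_simps(2))
      show "\<exists>N. \<forall>i\<ge>N. \<forall>x. Yc (u j) (Y2 a w2 (k + int i)) x = 0"
        using M2.eventually_zero_mode[of a w2 k] unfolding eventually_zero_def by (metis Yc_0(2))
    qed
    moreover have "l + int (Suc k) - int j = (l + int k - int j) + 1" for j by simp
    ultimately show ?thesis
      unfolding U_def Sum_any_diff[OF evU evU, symmetric]
      by (simp only: M3.scale_right_diff_distrib)
  qed
  \<comment> \<open>multiplication by \<open>(x\<^sub>1 - x)\<^sup>p\<close> annihilates all commutators with \<open>a\<close>\<close>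
  have Z_p: "(D1 ^^ p) (Z 0) m n r = 0" for m n r
  proof -
    have "(D1 ^^ p) (Z 0) m n r = Z p m n r"
      by (rule D1_funpow_eq[where G = "\<lambda>p m r. Z p m n r"]) (simp_all add: Z_Suc)
    also have "\<dots> = 0" by (simp add: Z_def K_eq_0 p)
    finally show ?thesis .
  qed
  have "Z 0 = (\<lambda>m n r. H 0 m n r - T 0 m n r)"
    by (simp add: fun_eq_iff H_0_eq)
  then have "(D2 ^^ q) (Z 0) = (\<lambda>m n r. H q m n r - T q m n r)"
    by (simp add: D2_funpow_diff D2_funpow_eq[of H, OF H_Suc] D2_funpow_eq[of T, OF T_Suc])
  \<comment> \<open>The two multiplications are interchanged so that \<open>(x1 - x)^p\<close> meets
    \<open>Z 0\<close> first.\<close>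
  then have "(D1 ^^ p) (\<lambda>m n r. H q m n r - T q m n r) = (D2 ^^ q) ((D1 ^^ p) (Z 0))"
    by (simp flip: funpow_D1_D2)
  also have "(D1 ^^ p) (Z 0) = (\<lambda>m n r. 0)" by (simp add: Z_p fun_eq_iff)
  finally have "(D1 ^^ p) (\<lambda>m n r. H q m n r - T q m n r) m 0 r = 0"
    by (simp add: D2_funpow_0)
  moreover have "(D1 ^^ p) (\<lambda>m n r. H q m n r - T q m n r) m 0 r = G p m r - U p m r"
  proof (rule D1_funpow_eq[where G = "\<lambda>k m r. G k m r - U k m r"])
    show "H q m 0 r - T q m 0 r = G 0 m r - U 0 m r" for m r
      unfolding H_n0 T_n0 G_def U_def h_def u_def by simp
  qed (simp add: G_Suc U_Suc)
  ultimately have "G p m r = U p m r" by simp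
  moreover have "G p m r = Sum_any (\<lambda>j. s3 ((-1) ^ j * (of_int l gchoose j))
     (bsum s3 (\<lambda>i. Yc (Y1 a (u j) (l + int p - int j + int i)) w2) m r))"
  proof -
    define F where "F = (\<lambda>s j. s3 ((-1) ^ j * (of_int l gchoose j) * (of_int m gchoose s))
      (Yc (Y1 a (u j) (l + int p - int j + int s)) w2 (of_int m + r - of_nat s)))"
    have evF: "eventually_zero2 F"
    proof (rule eventually_zero2I_right)
      show "\<exists>J. \<forall>j\<ge>J. \<forall>i. F i j = 0" by (rule exI[of _ N]) (simp add: N F_def)
      show "eventually_zero (\<lambda>i. F i j)" for j
        unfolding F_def by (rule eventually_zero_mono[OF M1.eventually_zero_mode[of a "u j" "l + int p - int j"]]) simp
    qed
    have "G p m r = Sum_any (\<lambda>s. Sum_any (\<lambda>j. F s j))"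
      unfolding G_def bsum_def
    proof (rule Sum_any.cong)
      fix s
      have ev: "eventually_zero (\<lambda>j. s3 (c j) (Yc (Y1 a (u j) (k j)) w2 x))" for c k x
        unfolding eventually_zero_def by (rule exI[of _ N]) (simp add: N)
      have "Yc (h (p + s)) w2 x = Sum_any (\<lambda>j. s3 ((-1) ^ j * (of_int l gchoose j))
          (Yc (Y1 a (u j) (l + int (p + s) - int j)) w2 x))" for x
        unfolding h_g[OF le_add1] linear_map_Sum_any[OF linear_Yc_left eventually_zero2_row[OF evg]]
        by (simp add: g_def linear_map_scale[OF linear_Yc_left])
      then show "s3 (of_int m gchoose s) (Yc (h (p + s)) w2 (of_int m + r - of_nat s)) = Sum_any (F s)"
        by (simp add: M3.scale_Sum_any[OF ev] F_def algebra_simps)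
    qed
    also have "\<dots> = Sum_any (\<lambda>j. Sum_any (\<lambda>s. F s j))" by (rule Sum_any_swap[OF evF])
    also have "\<dots> = Sum_any (\<lambda>j. s3 ((-1) ^ j * (of_int l gchoose j))
       (bsum s3 (\<lambda>i. Yc (Y1 a (u j) (l + int p - int j + int i)) w2) m r))"
    proof (rule Sum_any.cong)
      fix j
      have "eventually_zero (\<lambda>i. s3 (of_int m gchoose i) (Yc (Y1 a (u j) (l + int p - int j + int i)) w2 (of_int m + r - of_nat i)))"
        by (rule eventually_zero_mono[OF M1.eventually_zero_mode[of a "u j" "l + int p - int j"]]) simp
      then show "Sum_any (\<lambda>s. F s j) = s3 ((-1) ^ j * (of_int l gchoose j))
       (bsum s3 (\<lambda>i. Yc (Y1 a (u j) (l + int p - int j + int i)) w2) m r)"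
        by (simp add: bsum_def M3.scale_Sum_any F_def)
    qed
    finally show ?thesis .
  qed
  ultimately show ?thesis unfolding U_def u_def by simp
qed

end


section \<open>Vanishing of the Jacobi defect\<close>

definition jacobi_defect :: "'v \<Rightarrow> 'w1 \<Rightarrow> 'w2 \<Rightarrow> int \<Rightarrow> int \<Rightarrow> complex \<Rightarrow> 'w3" where
  "jacobi_defect a u w2 l m r = bsum s3 (\<lambda>i. Yc (Y1 a u (l + int i)) w2) m r
     - jsum s3 l (\<lambda>x s. Y3 a (Yc u w2 s) x) (\<lambda>x s. Yc u (Y2 a w2 x) s) m r"

lemma eventually_zero_defect_left: "eventually_zero (\<lambda>i. s3 (of_int m gchoose i) (Yc (Y1 a u (l + int i)) w2 (x i)))"
  by (rule eventually_zero_mono[OF M1.eventually_zero_mode[of a u l]]) simp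

lemma eventually_zero_defect_right: "eventually_zero (\<lambda>i. s3 ((-1) ^ i * (of_int l gchoose i))
      (Y3 a (Yc u w2 (r + of_nat i)) (k i) - s3 ((-1) powi l) (Yc u (Y2 a w2 (m + int i)) (x i))))"
  by (rule eventually_zero_mono2[OF eventually_zero_Yc[of u w2 r] M2.eventually_zero_mode[of a w2 m]]) simp

lemma jacobi_defect_0: "jacobi_defect a 0 w2 l m r = 0"
  by (simp add: jacobi_defect_def bsum_def jsum_def)

lemma jacobi_defect_add: "jacobi_defect a (u + u') w2 l m r = jacobi_defect a u w2 l m r + jacobi_defect a u' w2 l m r"
proof -
  have "bsum s3 (\<lambda>i. Yc (Y1 a (u + u') (l + int i)) w2) m r
      = bsum s3 (\<lambda>i. Yc (Y1 a u (l + int i)) w2) m r + bsum s3 (\<lambda>i. Yc (Y1 a u' (l + int i)) w2) m r"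
    unfolding bsum_def Sum_any_add[OF eventually_zero_defect_left eventually_zero_defect_left, symmetric]
    by (simp add: M1.YW_add linear_map_add[OF linear_Yc_left] M3.scale_right_distrib)
  moreover have "jsum s3 l (\<lambda>x s. Y3 a (Yc (u + u') w2 s) x) (\<lambda>x s. Yc (u + u') (Y2 a w2 x) s) m r
     = jsum s3 l (\<lambda>x s. Y3 a (Yc u w2 s) x) (\<lambda>x s. Yc u (Y2 a w2 x) s) m r
     + jsum s3 l (\<lambda>x s. Y3 a (Yc u' w2 s) x) (\<lambda>x s. Yc u' (Y2 a w2 x) s) m r"
    unfolding jsum_def Sum_any_add[OF eventually_zero_defect_right eventually_zero_defect_right, symmetric]
    by (rule Sum_any.cong) (simp add: M3.YW_add linear_map_add[OF linear_Yc_left]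
        M3.scale_right_distrib M3.scale_right_diff_distrib)
  ultimately show ?thesis by (simp add: jacobi_defect_def)
qed

lemma jacobi_defect_scale: "jacobi_defect a (s1 c u) w2 l m r = s3 c (jacobi_defect a u w2 l m r)"
proof -
  have "bsum s3 (\<lambda>i. Yc (Y1 a (s1 c u) (l + int i)) w2) m r
      = s3 c (bsum s3 (\<lambda>i. Yc (Y1 a u (l + int i)) w2) m r)"
    unfolding bsum_def M3.scale_Sum_any[OF eventually_zero_defect_left]
    by (simp add: M1.YW_scale linear_map_scale[OF linear_Yc_left] mult.commute)
  moreover have "jsum s3 l (\<lambda>x s. Y3 a (Yc (s1 c u) w2 s) x) (\<lambda>x s. Yc (s1 c u) (Y2 a w2 x) s) m r
     = s3 c (jsum s3 l (\<lambda>x s. Y3 a (Yc u w2 s) x) (\<lambda>x s. Yc u (Y2 a w2 x) s) m r)"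
    unfolding jsum_def M3.scale_Sum_any[OF eventually_zero_defect_right]
    by (rule Sum_any.cong) (simp add: M3.YW_scale linear_map_scale[OF linear_Yc_left]
        M3.scale_right_diff_distrib mult_ac)
  ultimately show ?thesis by (simp add: jacobi_defect_def M3.scale_right_diff_distrib)
qed

text \<open>By \<open>jacobi_sum_identity\<close> an alternating sum of defects of
  \<open>b_(q + j) w1\<close> vanishes. Downward induction on \<open>q\<close> removes the terms
  \<open>j > 0\<close>; it must cover all \<open>l\<close>, since the exponent changes with
  \<open>j\<close>.\<close>

lemma jacobi_defect_mode: "jacobi_defect a (Y1 b w1 (int q)) w2 l m r = 0"
proof -
  obtain N :: nat where N: "\<And>k. k \<ge> int N \<Longrightarrow> Y1 b w1 k = 0" using M1.truncation by blast
  obtain p :: nat where p: "\<And>k. k \<ge> int p \<Longrightarrow> Y1 a w1 k = 0" using M1.truncation by blast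
  have "\<forall>l. jacobi_defect a (Y1 b w1 (int q)) w2 l m r = 0"
  proof (rule nat_down_induct[where N = N and P = "\<lambda>q. \<forall>l. jacobi_defect a (Y1 b w1 (int q)) w2 l m r = 0"])
    fix q assume IH: "\<And>q'. q' > q \<Longrightarrow> \<forall>l. jacobi_defect a (Y1 b w1 (int q')) w2 l m r = 0"
    show "\<forall>l. jacobi_defect a (Y1 b w1 (int q)) w2 l m r = 0"
    proof
      fix l'
      define l where "l = l' - int p"
      have e1: "eventually_zero (\<lambda>j. s3 ((-1) ^ j * (of_int l gchoose j))
         (bsum s3 (\<lambda>i. Yc (Y1 a (Y1 b w1 (int q + int j)) (l + int p - int j + int i)) w2) m r))"
        by (rule eventually_zero_mono[OF M1.eventually_zero_mode[of b w1 "int q"]]) (simp add: bsum_def)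
      have e2: "eventually_zero (\<lambda>j. s3 ((-1) ^ j * (of_int l gchoose j))
         (jsum s3 (l + int p - int j) (\<lambda>x s. Y3 a (Yc (Y1 b w1 (int q + int j)) w2 s) x)
            (\<lambda>x s. Yc (Y1 b w1 (int q + int j)) (Y2 a w2 x) s) m r))"
        by (rule eventually_zero_mono[OF M1.eventually_zero_mode[of b w1 "int q"]]) (simp add: jsum_def)
      have "0 = Sum_any (\<lambda>j. s3 ((-1) ^ j * (of_int l gchoose j))
          (jacobi_defect a (Y1 b w1 (int q + int j)) w2 (l + int p - int j) m r))"
        unfolding jacobi_defect_def M3.scale_right_diff_distrib Sum_any_diff[OF e1 e2]
        by (simp only: jacobi_sum_identity[OF p] diff_self)
      also have "\<dots> = Sum_any (\<lambda>j::nat. if j = 0 then jacobi_defect a (Y1 b w1 (int q)) w2 l' m r else 0)"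
      proof (rule Sum_any.cong)
        fix j :: nat
        show "s3 ((-1) ^ j * (of_int l gchoose j)) (jacobi_defect a (Y1 b w1 (int q + int j)) w2 (l + int p - int j) m r)
          = (if j = 0 then jacobi_defect a (Y1 b w1 (int q)) w2 l' m r else 0)"
          using IH[of "q + j"] by (cases "j = 0") (simp_all add: l_def)
      qed
      finally show "jacobi_defect a (Y1 b w1 (int q)) w2 l' m r = 0" by simp
    qed
  qed (simp add: N jacobi_defect_0)
  then show ?thesis ..
qed

lemma imp_intertwining:
  assumes "gpos sV Y = UNIV"
  shows "intertwining om s1 Y1 s2 Y2 s3 Y3 Yc"
proof -
  let ?S = "{u. \<forall>a w2 l m r. jacobi_defect a u w2 l m r = 0}"
  have "M1.subspace ?S"
    unfolding M1.subspace_def by (simp add: jacobi_defect_0 jacobi_defect_add jacobi_defect_scale)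
  moreover have "jacobi_defect a (Y1 b w1 k) w2 l m r = 0" if "k \<ge> 0" for a b w1 w2 l m r k
    using jacobi_defect_mode[of a b w1 "nat k"] that by simp
  then have "{Y1 v w n | v w n. n \<ge> 0} \<subseteq> ?S" by blast
  ultimately have "gpos s1 Y1 \<subseteq> ?S"
    unfolding gpos_def by (rule M1.span_minimal[rotated])
  then have "jacobi_defect a u w2 l m r = 0" for a u w2 l m r
    using M1.gpos_UNIV[OF assms V] by blast
  then show ?thesis
    using quasi by (simp add: intertwining_def jacobi_defect_def bsum_def jsum_def)
qed

end

section \<open>The counterexamples\<close>

text \<open>Every vector is annihilated by a product of operators \<open>L - n\<close> with integral \<open>n\<close>, and such a
  product acts on an eigenvector of non-integral eigenvalue by a nonzero scalar.\<close>

lemma eigensp_non_integral: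
  assumes L: "Vector_Spaces.linear s s L"
    and span: "\<And>v. v \<in> module.span s (\<Union>n::int. eigensp s L (of_int n))"
    and h: "h \<notin> \<int>"
  shows "eigensp s L h = {0}"
proof -
  interpret L: Vector_Spaces.linear s s L by fact
  define f where "f = foldr (\<lambda>n v. L v - s (of_int n) v)"
  have f_simps: "f [] v = v" "f (n # ns) v = L (f ns v) - s (of_int n) (f ns v)" for n ns v
    by (simp_all add: f_def)
  have f_add: "f ns (v + w) = f ns v + f ns w" for ns v w
    by (induction ns) (simp_all add: f_simps L.add L.vs1.scale_right_distrib)
  have f_scale: "f ns (s a v) = s a (f ns v)" for ns a v
    by (induction ns) (simp_all add: f_simps L.scale L.vs1.scale_right_diff_distrib mult.commute)
  have f_0: "f ns 0 = 0" for ns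
    by (induction ns) (simp_all add: f_simps)
  have f_diff: "f ns (v - w) = f ns v - f ns w" for ns v w
    by (induction ns) (simp_all add: f_simps L.diff L.vs1.scale_right_diff_distrib)
  have f_L: "f ns (L v) = L (f ns v)" for ns v
    by (induction ns) (simp_all add: f_simps L.diff L.scale)
  have f_commute: "f ns (f ms v) = f ms (f ns v)" for ns ms v
    by (induction ns) (simp_all add: f_simps f_diff f_L f_scale)
  have f_append: "f (ns @ ms) v = f ns (f ms v)" for ns ms v
    by (simp add: f_def)
  have "L.vs1.subspace {v. \<exists>ns. f ns v = 0}"
    unfolding L.vs1.subspace_def
  proof safe
    show "\<exists>ns. f ns 0 = 0" by (simp add: f_0)
    fix v w ns ms assume "f ns v = 0" "f ms w = 0"
    \<comment> \<open>The two products commute, so the concatenated list annihilates both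
      summands.\<close>
    then have "f (ns @ ms) (v + w) = 0"
      by (simp add: f_append f_add f_commute[of ns ms v] f_0)
    then show "\<exists>ns. f ns (v + w) = 0" ..
  next
    fix a v ns assume "f ns v = 0"
    then have "f ns (s a v) = 0" by (simp add: f_scale)
    then show "\<exists>ns. f ns (s a v) = 0" ..
  qed
  moreover have "(\<Union>n::int. eigensp s L (of_int n)) \<subseteq> {v. \<exists>ns. f ns v = 0}"
  proof safe
    fix v and n :: int assume "v \<in> eigensp s L (of_int n)"
    then have "f [n] v = 0" by (simp add: f_simps eigensp_def)
    then show "\<exists>ns. f ns v = 0" ..
  qed
  ultimately have "module.span s (\<Union>n::int. eigensp s L (of_int n)) \<subseteq> {v. \<exists>ns. f ns v = 0}"
    by (rule L.vs1.span_minimal[rotated])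
  then have ex: "\<exists>ns. f ns v = 0" for v using span by blast
  have "v = 0" if v: "L v = s h v" for v
  proof -
    have "f ns v = s (\<Prod>n\<leftarrow>ns. h - of_int n) v" for ns
      by (induction ns) (simp_all add: f_simps L.scale v algebra_simps L.vs1.scale_left_diff_distrib)
    moreover have "(\<Prod>n\<leftarrow>ns. h - of_int n) \<noteq> 0" for ns
      using h by (auto simp: prod_list_zero_iff)
    ultimately show ?thesis using ex[of v] by auto
  qed
  then show ?thesis by (auto simp: eigensp_def)
qed

text \<open>The algebra is graded by integers, a module by complex numbers. Non-integral weight
  spaces are zero, and the integral ones are controlled by the axioms of the algebra.\<close>

lemma VOA_module_self:
  assumes "VOA sV Y vac om c"
  shows "VOA_module sV Y vac om sV Y"
proof -
  have wm: "weak_module sV Y vac sV Y"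
    and span: "\<And>v. v \<in> module.span sV (\<Union>n::int. eigensp sV (\<lambda>x. Y om x 1) (of_int n))"
    and fin: "\<And>n::int. fin_dim_subset sV (eigensp sV (\<lambda>x. Y om x 1) (of_int n))"
    and bdd: "\<exists>N::int. \<forall>n<N. eigensp sV (\<lambda>x. Y om x 1) (of_int n) = {0}"
    using assms by (auto simp: VOA_def vertex_algebra_def)
  interpret weak_V_module sV Y vac sV Y by unfold_locales (rule wm)
  have triv: "eigensp sV (\<lambda>x. Y om x 1) h = {0}" if "h \<notin> \<int>" for h
    by (rule eigensp_non_integral[OF linear_right span that])
  have "v \<in> span (\<Union>h. eigensp sV (\<lambda>x. Y om x 1) h)" for v
    by (rule subsetD[OF span_mono span]) blast
  moreover have "fin_dim_subset sV (eigensp sV (\<lambda>x. Y om x 1) h)" for h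
  proof (cases "h \<in> \<int>")
    case True
    then show ?thesis using fin by (auto elim: Ints_cases)
  next
    case False
    show ?thesis unfolding triv[OF False] fin_dim_subset_def
      by (rule exI[of _ "{}"]) simp
  qed
  moreover have "\<exists>N::int. \<forall>k<N. eigensp sV (\<lambda>x. Y om x 1) (h + of_int k) = {0}" for h
  proof (cases "h \<in> \<int>")
    case True
    then obtain n where h: "h = of_int n" by (auto elim: Ints_cases)
    obtain N :: int where N: "\<And>k. k < N \<Longrightarrow> eigensp sV (\<lambda>x. Y om x 1) (of_int k) = {0}"
      using bdd by blast
    have "eigensp sV (\<lambda>x. Y om x 1) (h + of_int k) = {0}" if "k < N - n" for k
      using N[of "n + k"] that by (simp add: h)
    then show ?thesis by blast
  next
    case False
    have "h + of_int k \<notin> \<int>" for k :: int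
      using False Ints_diff[of "h + of_int k" "of_int k"] by auto
    then show ?thesis using triv by blast
  qed
  ultimately show ?thesis using wm by (simp add: VOA_module_def)
qed

text \<open>A basis of \<open>S\<close> together with \<open>x\<close> is independent, so the values
  0 on the basis and 1 at \<open>x\<close> extend linearly.\<close>

lemma (in vector_space) ex_functional:
  assumes "subspace S" "x \<notin> S"
  obtains f where "Vector_Spaces.linear scale (*) f" "f x = 1" "\<And>v. v \<in> S \<Longrightarrow> f v = 0"
proof -
  obtain B where B: "B \<subseteq> S" "independent B" "span B = S"
    using basis_exists[of S] assms(1) by (metis span_minimal subset_antisym)
  interpret vector_space_pair scale "(*)"
    by unfold_locales (simp_all add: algebra_simps)
  have "independent (insert x B)"
    using B assms(2) by (simp add: independent_insert)
  then obtain f where f: "Vector_Spaces.linear scale (*) f" "\<forall>y\<in>insert x B. f y = (if y = x then 1 else 0)"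
    using linear_independent_extend[of "insert x B" "\<lambda>y. if y = x then 1 else 0"] by blast
  have "f v = 0" if "v \<in> S" for v
    by (rule linear_eq_0_on_span[OF f(1), of B]) (use f(2) B that assms(2) in auto)
  then show ?thesis using that f by simp
qed

section \<open>Operators built from a functional that kills the nonnegative modes\<close>

locale gpos_functional = weak_V_module sV Y vac sV Y
  for sV :: "complex \<Rightarrow> 'v::ab_group_add \<Rightarrow> 'v" and Y vac +
  fixes f :: "'v \<Rightarrow> complex"
  assumes creation: "\<And>v n. n \<ge> 0 \<Longrightarrow> Y v vac n = 0" "\<And>v. Y v vac (-1) = v"
    and linear_f: "Vector_Spaces.linear sV (*) f"
    and f_mode: "\<And>v w n. n \<ge> 0 \<Longrightarrow> f (Y v w n) = 0"
    and f_nonzero: "\<exists>v. f v \<noteq> 0"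
    and dim: "dim_gt_one sV"
begin

text \<open>Otherwise a vector with \<open>f x\<close> nonzero forces \<open>f vac\<close> to be
  nonzero, and every \<open>v\<close> becomes a multiple of \<open>vac\<close>. Both counterexamples
  fail through this equation.\<close>

lemma not_proportional: "\<exists>v. sV (f v) vac \<noteq> sV (f vac) v"
proof (rule ccontr)
  assume "\<not> ?thesis"
  then have eq: "sV (f v) vac = sV (f vac) v" for v by blast
  obtain x where x: "f x \<noteq> 0" using f_nonzero by blast
  have "vac \<noteq> 0"
    using creation(2)[of x] x linear_map_0[OF linear_f] by auto
  with eq[of x] x have "f vac \<noteq> 0" by auto
  then have "v = sV (f v / f vac) vac" for v
    using arg_cong[OF eq[of v], of "sV (1 / f vac)"] by simp
  then have "v \<in> span {vac}" for v
    by (metis span_base span_scale singletonI)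
  then show False using dim by (auto simp: dim_gt_one_def)
qed

lemma linear_functional_vac: "Vector_Spaces.linear sV sV (\<lambda>v. sV (f v) w)"
  by (simp add: Vector_Spaces.linear_iff vector_space_axioms linear_map_add[OF linear_f]
      linear_map_scale[OF linear_f] scale_left_distrib)

text \<open>Both sides are zero: \<open>f\<close> kills nonnegative modes, and nonnegative modes
  kill the vacuum.\<close>

lemma gpos_hom_functional: "gpos_hom sV Y sV Y (\<lambda>v. sV (f v) vac)"
  by (simp add: gpos_hom_def linear_functional_vac f_mode YW_scale creation)

lemma not_V_hom_functional: "\<not> V_hom sV Y sV Y (\<lambda>v. sV (f v) vac)"
proof
  assume "V_hom sV Y sV Y (\<lambda>v. sV (f v) vac)"
  then have "sV (f (Y v vac (-1))) vac = Y v (sV (f vac) vac) (-1)" for v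
    unfolding V_hom_def by blast
  then show False using not_proportional by (simp add: creation YW_scale)
qed

text \<open>The coefficient at \<open>n = -1\<close> belongs to \<open>x^0\<close>, so this is a
  constant series.\<close>

definition Yc :: "'v \<Rightarrow> 'v \<Rightarrow> complex \<Rightarrow> 'v" where
  "Yc w1 w2 n = (if n = -1 then sV (f w1) w2 else 0)"

lemma quasi_intertwining_functional: "quasi_intertwining om sV Y sV Y sV Y Yc"
  unfolding quasi_intertwining_def
proof (intro conjI allI)
  have Yc_mode: "Yc (Y v w1 (int i)) w2 n = 0" for v w1 i w2 n
    by (simp add: Yc_def f_mode)
  have linear_0: "Vector_Spaces.linear sV sV (\<lambda>v. 0)"
    by (simp add: Vector_Spaces.linear_iff vector_space_axioms)
  fix v w1 w2 n and m :: int
  show "Vector_Spaces.linear sV sV (\<lambda>w1. Yc w1 w2 n)"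
    using linear_functional_vac linear_0 by (cases "n = -1") (simp_all add: Yc_def)
  show "Vector_Spaces.linear sV sV (\<lambda>w2. Yc w1 w2 n)"
    using linear_scale_self linear_0 by (cases "n = -1") (simp_all add: Yc_def)
  show "\<exists>R::real. \<forall>n. Re n > R \<longrightarrow> Yc w1 w2 n = 0"
    by (rule exI[of _ 0]) (auto simp: Yc_def)
  \<comment> \<open>The right side vanishes because \<open>f\<close> kills nonnegative modes, the
    left because scalars commute with modes.\<close>
  show "Y v (Yc w1 w2 n) m - Yc w1 (Y v w2 m) n
      = Sum_any (\<lambda>i::nat. sV (of_int m gchoose i) (Yc (Y v w1 (int i)) w2 (of_int m + n - of_nat i)))"
    by (simp only: Yc_mode) (simp add: Yc_def YW_scale)
  \<comment> \<open>On the right the coefficient can be nonzero only for \<open>n = 0\<close>, where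
    the factor \<open>- n\<close> vanishes.\<close>
  show "Yc (Y om w1 0) w2 n = sV (- n) (Yc w1 w2 (n - 1))"
    by (simp add: Yc_def f_mode)
qed

lemma not_intertwining_functional: "\<not> intertwining om sV Y sV Y sV Y Yc"
proof
  assume "intertwining om sV Y sV Y sV Y Yc"
  \<comment> \<open>At \<open>l = -1\<close>, \<open>m = 0\<close>, \<open>n = -1\<close> on vacuum
    vectors only \<open>i = 0\<close> survives, and the two sides are \<open>f(v) vac\<close> and
    \<open>f(vac) v\<close>.\<close>
  then have "Sum_any (\<lambda>i::nat. sV (of_int 0 gchoose i)
             (Yc (Y v vac (-1 + int i)) vac (of_int 0 + (-1) - of_nat i)))
        = Sum_any (\<lambda>i::nat. sV ((-1) ^ i * (of_int (-1) gchoose i))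
             (Y v (Yc vac vac ((-1) + of_nat i)) ((-1) + 0 - int i)
              - sV ((-1::complex) powi (-1)) (Yc vac (Y v vac (0 + int i)) (of_int (-1) + (-1) - of_nat i))))" for v
    unfolding intertwining_def by blast
  moreover have "Sum_any (\<lambda>i::nat. sV (of_int 0 gchoose i)
             (Yc (Y v vac (-1 + int i)) vac (of_int 0 + (-1) - of_nat i)))
      = Sum_any (\<lambda>i::nat. if i = 0 then sV (f v) vac else 0)" for v
    by (rule Sum_any.cong) (auto simp: Yc_def creation)
  moreover have "Sum_any (\<lambda>i::nat. sV ((-1) ^ i * (of_int (-1) gchoose i))
             (Y v (Yc vac vac ((-1) + of_nat i)) ((-1) + 0 - int i)
              - sV ((-1::complex) powi (-1)) (Yc vac (Y v vac (0 + int i)) (of_int (-1) + (-1) - of_nat i))))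
      = Sum_any (\<lambda>i::nat. if i = 0 then sV (f vac) v else 0)" for v
    by (rule Sum_any.cong) (auto simp: Yc_def creation YW_scale)
  ultimately have "sV (f v) vac = sV (f vac) v" for v by simp
  then show False using not_proportional by blast
qed

end

lemma ex_gpos_functional:
  assumes VOA: "VOA sV Y vac om c" and gp: "gpos sV Y \<noteq> UNIV" and dim: "dim_gt_one sV"
  obtains f where "gpos_functional sV Y vac f"
proof -
  have wm: "weak_module sV Y vac sV Y" and cr: "\<And>v n. n \<ge> 0 \<Longrightarrow> Y v vac n = 0" "\<And>v. Y v vac (-1) = v"
    using VOA by (auto simp: VOA_def vertex_algebra_def)
  interpret weak_V_module sV Y vac sV Y by unfold_locales (rule wm)
  obtain x where "x \<notin> gpos sV Y" using gp by blast
  moreover have "subspace (gpos sV Y)" by (simp add: gpos_def)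
  ultimately obtain f where f: "Vector_Spaces.linear sV (*) f" "f x = 1" "\<And>v. v \<in> gpos sV Y \<Longrightarrow> f v = 0"
    using ex_functional by blast
  have "Y v w n \<in> gpos sV Y" if "n \<ge> 0" for v w n
    using that unfolding gpos_def by (blast intro: span_base)
  then have "gpos_functional sV Y vac f"
    by (intro gpos_functional.intro[OF weak_V_module_axioms] gpos_functional_axioms.intro)
      (use cr f dim in \<open>auto intro!: exI[of _ x]\<close>)
  then show ?thesis by (rule that)
qed

theorem mainTheorem15:
  fixes sV :: "complex \<Rightarrow> 'v::ab_group_add \<Rightarrow> 'v"
    and Y :: "'v \<Rightarrow> 'v \<Rightarrow> int \<Rightarrow> 'v"
    and vac om :: 'v and c :: complex
  assumes "VOA sV Y vac om c"
  shows
   "(gpos sV Y = UNIV \<longrightarrow>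
      (\<forall>(s1 :: complex \<Rightarrow> 'w1::ab_group_add \<Rightarrow> 'w1) Y1
          (s2 :: complex \<Rightarrow> 'w2::ab_group_add \<Rightarrow> 'w2) Y2 f.
         weak_module sV Y vac s1 Y1 \<and> weak_module sV Y vac s2 Y2 \<and> gpos_hom s1 Y1 s2 Y2 f
         \<longrightarrow> V_hom s1 Y1 s2 Y2 f) \<and>
      (\<forall>(s1 :: complex \<Rightarrow> 'w1 \<Rightarrow> 'w1) Y1 (s2 :: complex \<Rightarrow> 'w2 \<Rightarrow> 'w2) Y2
          (s3 :: complex \<Rightarrow> 'w3::ab_group_add \<Rightarrow> 'w3) Y3 Yc.
         weak_module sV Y vac s1 Y1 \<and> weak_module sV Y vac s2 Y2 \<and> weak_module sV Y vac s3 Y3 \<and>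
         quasi_intertwining om s1 Y1 s2 Y2 s3 Y3 Yc
         \<longrightarrow> intertwining om s1 Y1 s2 Y2 s3 Y3 Yc))
    \<and>
    (gpos sV Y \<noteq> UNIV \<and> dim_gt_one sV \<longrightarrow>
      (\<exists>(s1 :: complex \<Rightarrow> 'v \<Rightarrow> 'v) Y1 (s2 :: complex \<Rightarrow> 'v \<Rightarrow> 'v) Y2 f.
         VOA_module sV Y vac om s1 Y1 \<and> VOA_module sV Y vac om s2 Y2 \<and>
         gpos_hom s1 Y1 s2 Y2 f \<and> \<not> V_hom s1 Y1 s2 Y2 f) \<and>
      (\<exists>(s1 :: complex \<Rightarrow> 'v \<Rightarrow> 'v) Y1 (s2 :: complex \<Rightarrow> 'v \<Rightarrow> 'v) Y2
          (s3 :: complex \<Rightarrow> 'v \<Rightarrow> 'v) Y3 Yc.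
         VOA_module sV Y vac om s1 Y1 \<and> VOA_module sV Y vac om s2 Y2 \<and>
         VOA_module sV Y vac om s3 Y3 \<and>
         quasi_intertwining om s1 Y1 s2 Y2 s3 Y3 Yc \<and>
         \<not> intertwining om s1 Y1 s2 Y2 s3 Y3 Yc))"
proof -
  have wm: "weak_module sV Y vac sV Y"
    using assms by (auto simp: VOA_def vertex_algebra_def)
  note self = VOA_module_self[OF assms]
  show ?thesis
  proof (intro conjI impI allI; (elim conjE)?)
    fix s1 :: "complex \<Rightarrow> 'w1 \<Rightarrow> 'w1" and Y1 and s2 :: "complex \<Rightarrow> 'w2 \<Rightarrow> 'w2" and Y2 f
    assume "gpos sV Y = UNIV" "weak_module sV Y vac s1 Y1" "weak_module sV Y vac s2 Y2"
      "gpos_hom s1 Y1 s2 Y2 f"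
    then show "V_hom s1 Y1 s2 Y2 f" using gpos_hom_imp_V_hom[OF wm] by blast
  next
    fix s1 :: "complex \<Rightarrow> 'w1 \<Rightarrow> 'w1" and Y1 and s2 :: "complex \<Rightarrow> 'w2 \<Rightarrow> 'w2" and Y2
      and s3 :: "complex \<Rightarrow> 'w3 \<Rightarrow> 'w3" and Y3 Yc
    assume *: "gpos sV Y = UNIV" "weak_module sV Y vac s1 Y1" "weak_module sV Y vac s2 Y2"
      "weak_module sV Y vac s3 Y3" "quasi_intertwining om s1 Y1 s2 Y2 s3 Y3 Yc"
    then interpret quasi_intertwining_op sV Y vac s1 Y1 s2 Y2 s3 Y3 om Yc
      by unfold_locales (use wm in auto)
    show "intertwining om s1 Y1 s2 Y2 s3 Y3 Yc" using *(1) by (rule imp_intertwining)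
  next
    assume "gpos sV Y \<noteq> UNIV" "dim_gt_one sV"
    then obtain f where "gpos_functional sV Y vac f" using ex_gpos_functional[OF assms] by blast
    then interpret gpos_functional sV Y vac f .
    show "\<exists>(s1 :: complex \<Rightarrow> 'v \<Rightarrow> 'v) Y1 (s2 :: complex \<Rightarrow> 'v \<Rightarrow> 'v) Y2 f.
         VOA_module sV Y vac om s1 Y1 \<and> VOA_module sV Y vac om s2 Y2 \<and>
         gpos_hom s1 Y1 s2 Y2 f \<and> \<not> V_hom s1 Y1 s2 Y2 f"
      using self gpos_hom_functional not_V_hom_functional by blast
    show "\<exists>(s1 :: complex \<Rightarrow> 'v \<Rightarrow> 'v) Y1 (s2 :: complex \<Rightarrow> 'v \<Rightarrow> 'v) Y2
          (s3 :: complex \<Rightarrow> 'v \<Rightarrow> 'v) Y3 Yc.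
         VOA_module sV Y vac om s1 Y1 \<and> VOA_module sV Y vac om s2 Y2 \<and>
         VOA_module sV Y vac om s3 Y3 \<and>
         quasi_intertwining om s1 Y1 s2 Y2 s3 Y3 Yc \<and>
         \<not> intertwining om s1 Y1 s2 Y2 s3 Y3 Yc"
      using self quasi_intertwining_functional not_intertwining_functional by blast
  qed
qed

end
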